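(* Let $1\le k\le d$ be integers. (i) Suppose $k>1$. If $d\not\equiv 1 \pmod 4$, there exist a constant $C_{d,k}>0$ and $\rho_0>0$ such that for every $\rho\ge\rho_0$ there exists $\mathbf k_1\in\mathbb T^k$ with $$R(\rho;\mathbf k_1;d,k)\ge C_{d,k}\,\rho^{\frac{d-1}{2}}.$$ If $d\equiv 1\pmod 4$, there exists a constant $C_{d,k}>0$ such that for every $\epsilon>0$ there is $\rho_0>0$ such that for every $\rho\ge\rho_0$ there exists $\mathbf k_1\in\mathbb T^k$ with $$R(\rho;\mathbf k_1;d,k)\ge C_{d,k}\,\rho^{\frac{d-1-\epsilon}{2}}.$$ (ii) Suppose $k=1$ and $d\not\equiv 1\pmod 4$. Then there exist a constant $C_{d,k}>0$ and $\rho_0>0$ such that for every $\rho\ge\rho_0$ there exists $\mathbf k_1\in\mathbb T^k$ with $R(\rho;\mathbf k_1;d,k)\ge C_{d,k}\,\rho^{\frac{d-1}{2}}$.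
   Context: Put $l=d-k$, $\mathbb T^k=\mathbb R^k/\mathbb Z^k$, and let $\omega_n=\pi^{n/2}/\Gamma(1+n/2)$ be the volume of the unit ball in $\mathbb R^n$ (so $\omega_0=1$). For $\rho>0$ and $\mathbf k_1\in\mathbb R^k$, $$S(\rho;\mathbf k_1;d,k)=\omega_l\sum_{\gamma\in\mathbb Z^k,\ |\gamma-\mathbf k_1|<\rho}(\rho^2-|\gamma-\mathbf k_1|^2)^{l/2}$$ (for $l=0$ this is the number of $\gamma\in\mathbb Z^d$ with $|\gamma-\mathbf k_1|<\rho$). This is the $l$-dimensional volume of the intersection of $\mathbb Z^k\times\mathbb R^{d-k}$ with a ball of radius $\rho$ in $\mathbb R^d$ centred at a point $(\mathbf k_1,\mathbf k_2)$. The error term is $R(\rho;\mathbf k_1;d,k)=S(\rho;\mathbf k_1;d,k)-\omega_d\rho^d$; it is $\mathbb Z^k$-periodic in $\mathbf k_1$, hence a function of $\mathbf k_1\in\mathbb T^k$. *)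

theory Defs
  imports "HOL-Analysis.Analysis"
begin

definition int_lattice :: "(real ^ 'k::finite) set" where
  "int_lattice = {\<gamma>. \<forall>i. \<gamma> $ i \<in> \<int>}"

lemma int_lattice_zero: "0 \<in> int_lattice"
  by (simp add: int_lattice_def)

lemma int_lattice_add: "x \<in> int_lattice \<Longrightarrow> y \<in> int_lattice \<Longrightarrow> x + y \<in> int_lattice"
  by (simp add: int_lattice_def)

lemma int_lattice_uminus: "x \<in> int_lattice \<Longrightarrow> - x \<in> int_lattice"
  by (simp add: int_lattice_def)

lemma int_lattice_diff: "x \<in> int_lattice \<Longrightarrow> y \<in> int_lattice \<Longrightarrow> x - y \<in> int_lattice"
  by (simp add: int_lattice_def)

lemma finite_int_lattice_ball:
  fixes x :: "real ^ 'k::finite"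
  shows "finite {\<gamma> \<in> int_lattice. norm (\<gamma> - x) < \<rho>}"
proof -
  define F :: "real set" where "F = (\<Union>i. of_int ` {\<lfloor>x $ i - \<rho>\<rfloor>..\<lceil>x $ i + \<rho>\<rceil>})"
  have "finite F"
    unfolding F_def by (intro finite_UN_I) auto
  have "\<gamma> \<in> {\<gamma>. \<forall>i. \<gamma> $ i \<in> F}" if \<gamma>: "\<gamma> \<in> int_lattice" "norm (\<gamma> - x) < \<rho>" for \<gamma>
  proof (safe)
    fix i
    have "\<bar>\<gamma> $ i - x $ i\<bar> < \<rho>"
      using component_le_norm_cart[of "\<gamma> - x" i] \<gamma>(2) by simp
    moreover obtain n where n: "\<gamma> $ i = of_int n"
      using \<gamma>(1) unfolding int_lattice_def Ints_def by blast
    ultimately have "n \<in> {\<lfloor>x $ i - \<rho>\<rfloor>..\<lceil>x $ i + \<rho>\<rceil>}"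
      unfolding atLeastAtMost_iff floor_le_iff le_ceiling_iff abs_less_iff n by linarith
    with n show "\<gamma> $ i \<in> F"
      unfolding F_def by blast
  qed
  then have "{\<gamma> \<in> int_lattice. norm (\<gamma> - x) < \<rho>} \<subseteq> {\<gamma>. \<forall>i. \<gamma> $ i \<in> F}"
    by blast
  moreover have "finite {\<gamma> :: real ^ 'k. \<forall>i. \<gamma> $ i \<in> F}"
  proof (rule finite_subset)
    show "{\<gamma> :: real ^ 'k. \<forall>i. \<gamma> $ i \<in> F} \<subseteq> vec_lambda ` (\<Pi>\<^sub>E i\<in>UNIV. F)"
    proof
      fix \<gamma> :: "real ^ 'k"
      assume "\<gamma> \<in> {\<gamma>. \<forall>i. \<gamma> $ i \<in> F}"
      then show "\<gamma> \<in> vec_lambda ` (\<Pi>\<^sub>E i\<in>UNIV. F)"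
        by (intro image_eqI[where x = "vec_nth \<gamma>"]) auto
    qed
    show "finite (vec_lambda ` (\<Pi>\<^sub>E i\<in>(UNIV :: 'k set). F))"
      using \<open>finite F\<close> by (intro finite_imageI finite_PiE) auto
  qed
  ultimately show ?thesis
    by (rule finite_subset)
qed

text \<open>
  Here \<open>k\<close> is \<^term>\<open>CARD('k)\<close>, and \<^term>\<open>d\<close> is meant to satisfy
  \<^term>\<open>CARD('k) \<le> d\<close>, so that the subtraction \<open>l = d - k\<close> does not truncate.
  The sum ranges over a finite set (\<open>finite_int_lattice_ball\<close>) with a strict condition, so the base
  of \<open>powr\<close> is always positive; in particular, for \<open>l = 0\<close> every summand is \<open>1\<close>.
\<close>

definition S_vol :: "nat \<Rightarrow> real \<Rightarrow> real ^ 'k::finite \<Rightarrow> real" where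
  "S_vol d \<rho> x =
     (let l = d - CARD('k) in
      unit_ball_vol (real l) *
      (\<Sum>\<gamma> | \<gamma> \<in> int_lattice \<and> norm (\<gamma> - x) < \<rho>.
         (\<rho>\<^sup>2 - (norm (\<gamma> - x))\<^sup>2) powr (real l / 2)))"

definition R_err :: "nat \<Rightarrow> real \<Rightarrow> real ^ 'k::finite \<Rightarrow> real" where
  "R_err d \<rho> x = S_vol d \<rho> x - unit_ball_vol (real d) * \<rho> ^ d"

lemma S_vol_periodic:
  fixes x z :: "real ^ 'k::finite"
  assumes "z \<in> int_lattice"
  shows "S_vol d \<rho> (x + z) = S_vol d \<rho> x"
proof -
  have "(\<Sum>\<gamma> | \<gamma> \<in> int_lattice \<and> norm (\<gamma> - (x + z)) < \<rho>.
           (\<rho>\<^sup>2 - (norm (\<gamma> - (x + z)))\<^sup>2) powr e)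
      = (\<Sum>\<gamma> | \<gamma> \<in> int_lattice \<and> norm (\<gamma> - x) < \<rho>.
           (\<rho>\<^sup>2 - (norm (\<gamma> - x))\<^sup>2) powr e)" for e
    by (rule sum.reindex_bij_witness[where i = "\<lambda>\<gamma>. \<gamma> + z" and j = "\<lambda>\<gamma>. \<gamma> - z"])
       (use assms in \<open>auto simp: int_lattice_add int_lattice_diff diff_diff_eq add.commute\<close>)
  then show ?thesis
    by (simp add: S_vol_def)
qed

lemma R_err_periodic:
  "z \<in> int_lattice \<Longrightarrow> R_err d \<rho> (x + z) = R_err d \<rho> x"
  by (simp add: R_err_def S_vol_periodic)

quotient_type (overloaded) 'k torus =
  "real ^ 'k::finite" / "\<lambda>x y. x - y \<in> int_lattice"
proof (rule equivpI)
  show "reflp (\<lambda>x y :: real ^ 'k. x - y \<in> int_lattice)"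
    by (simp add: reflp_def int_lattice_zero)
  show "symp (\<lambda>x y :: real ^ 'k. x - y \<in> int_lattice)"
    proof (rule sympI)
    fix x y :: "real ^ 'k"
    assume "x - y \<in> int_lattice"
    from int_lattice_uminus[OF this] show "y - x \<in> int_lattice"
      by simp
  qed
  show "transp (\<lambda>x y :: real ^ 'k. x - y \<in> int_lattice)"
    proof (rule transpI)
    fix x y z :: "real ^ 'k"
    assume "x - y \<in> int_lattice" "y - z \<in> int_lattice"
    from int_lattice_add[OF this] show "x - z \<in> int_lattice"
      by simp
  qed
qed

lift_definition R_torus :: "nat \<Rightarrow> real \<Rightarrow> 'k::finite torus \<Rightarrow> real" is R_err
proof -
  fix d :: nat and \<rho> :: real and x y :: "real ^ 'k"
  assume "x - y \<in> int_lattice"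
  from R_err_periodic[OF this, of d \<rho> y] show "R_err d \<rho> x = R_err d \<rho> y"
    by simp
qed

end

theory Submission
  imports Defs "HOL-Complex_Analysis.Complex_Analysis" "HOL-Real_Asymp.Real_Asymp"
begin

text \<open>
  The function \<open>x \<mapsto> S_vol d \<rho> x\<close> is the periodization over the lattice of the radial
  function \<open>F y = \<omega>\<^sub>l (\<rho>\<^sup>2 - |y|\<^sup>2)\<^bsup>l/2\<^esup>\<close>, which is the volume of the slice above \<open>y\<close> of the
  \<open>d\<close>-dimensional ball of radius \<open>\<rho>\<close>. Its Fourier coefficient at a lattice vector \<open>g\<close> is
  therefore the Fourier transform of \<open>F\<close> at \<open>g\<close>: it equals \<open>\<omega>\<^sub>d \<rho>\<^sup>d\<close> for \<open>g = 0\<close>, and for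
  \<open>g \<noteq> 0\<close> slicing the ball by hyperplanes orthogonal to \<open>g\<close> gives
  \<open>J = \<omega>\<^bsub>d-1\<^esub> \<rho>\<^sup>d I (2\<pi>\<rho>|g|)\<close>, where \<open>I z\<close> is the integral of
  \<open>(1 - t\<^sup>2)\<^bsup>(d-1)/2\<^esup> cos (z t)\<close> over \<open>[-1, 1]\<close>, a Bessel function up to elementary factors
  (\<open>nn_integral_wave_S_vol\<close>).

  Testing against the weights \<open>1 \<plusminus> cos (2\<pi> x \<bullet> g)\<close> turns one large coefficient into a one-sided
  bound. These weights are nonnegative with mean \<open>1\<close>, and the weighted mean of the error term
  is \<open>\<plusminus>J\<close>; hence its supremum is at least \<open>|J|\<close> (\<open>R_err_large\<close>).

  Moving the contour of \<open>I z\<close> into the upper half plane leaves only the contributions of the two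
  end points, so that \<open>z\<^bsup>(d+1)/2\<^esup> I z\<close> is a positive multiple of \<open>sin (z - \<theta>)\<close> up to \<open>o(1)\<close>, with
  the phase \<open>\<theta> = (d-1)\<pi>/4\<close> (\<open>bessel_integral_asymptotics\<close>). A frequency \<open>g\<close> for which this sine
  is bounded below gives an error term of size \<open>\<rho>\<^bsup>(d-1)/2\<^esup> |g|\<^bsup>-(d+1)/2\<^esup>\<close>
  (\<open>R_err_lower_bound\<close>). It remains to find such a \<open>g\<close> that is short.

  If \<open>d\<close> is not \<open>1\<close> modulo \<open>4\<close>, then \<open>sin \<theta> \<noteq> 0\<close>. Since \<open>\<theta> = (2z - \<theta>) - 2(z - \<theta>)\<close>,
  the sines of \<open>z - \<theta>\<close> and \<open>2z - \<theta>\<close> cannot both be small, so one of \<open>e\<close> and \<open>2e\<close>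
  with a unit vector \<open>e\<close> of the lattice will do.

  If \<open>d\<close> is \<open>1\<close> modulo \<open>4\<close>, the sine is \<open>\<plusminus>sin (2\<pi>\<rho>|g|)\<close>, and the vectors \<open>g = (m, 1, 0, \<dots>)\<close>
  are used, whose norms are values of \<open>f x = sqrt (x\<^sup>2 + 1)\<close>. For every \<open>s\<close> there is an integral
  combination of \<open>f x, f (2x), \<dots>, f (2\<^sup>s x)\<close> that cancels the first \<open>s\<close> terms of the expansion of
  \<open>f\<close> at infinity and hence is asymptotic to a nonzero multiple of \<open>x\<^bsup>1-2s\<^esup>\<close>. Choosing \<open>x\<close> of
  order \<open>\<rho>\<^bsup>1/(2s-1)\<^esup>\<close> makes \<open>2\<pi>\<rho>\<close> times this combination close to \<open>\<pi>/2\<close> in absolute value;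
  then the sines of its finitely many constituents cannot all be small
  (\<open>sin_sqrt_square_plus_one_large\<close>). As \<open>s\<close> is arbitrary, \<open>|g|\<close> is at most an arbitrarily small
  power of \<open>\<rho>\<close>.
\<close>

section \<open>Slices of balls\<close>

text \<open>
  The volume of the \<open>n\<close>-dimensional ball of squared radius \<open>s\<close>. Using the squared radius, with the
  value \<open>0\<close> for \<open>s \<le> 0\<close>, makes Pythagoras' theorem a subtraction that is valid without case
  distinctions: the slice at height \<open>t\<close> has the parameter \<open>s - t\<^sup>2\<close>.
\<close>

definition ball_volume_sq :: "nat \<Rightarrow> real \<Rightarrow> real" where
  "ball_volume_sq n s = unit_ball_vol (real n) * (if s > 0 then sqrt s ^ n else 0)"

lemma ball_volume_sq_nonneg [simp]: "ball_volume_sq n s \<ge> 0"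
  by (simp add: ball_volume_sq_def)

lemma ball_volume_sq_nonpos [simp]: "s \<le> 0 \<Longrightarrow> ball_volume_sq n s = 0"
  by (simp add: ball_volume_sq_def)

lemma borel_measurable_ball_volume_sq [measurable]: "ball_volume_sq n \<in> borel_measurable borel"
  unfolding ball_volume_sq_def[abs_def] by measurable

lemma ball_volume_sq_scale:
  assumes "r > 0"
  shows "ball_volume_sq n (r\<^sup>2 * s) = r ^ n * ball_volume_sq n s"
  using assms
  by (auto simp: ball_volume_sq_def real_sqrt_mult power_mult_distrib zero_less_mult_iff)

lemma unit_ball_vol_Suc_Beta:
  "unit_ball_vol (real n) * Beta (1/2) (real n / 2 + 1) = unit_ball_vol (real (Suc n))"
  by (auto simp: unit_ball_vol_def Beta_def Gamma_eq_zero_iff field_simps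
          Gamma_one_half_real powr_half_sqrt [symmetric] powr_add [symmetric])

text \<open>
  Cavalieri's principle. After rescaling to \<open>s = 1\<close> the integral is a Beta integral, and
  \<open>unit_ball_vol_Suc_Beta\<close> is the recursion of the volumes of unit balls.
\<close>

lemma nn_integral_ball_volume_sq:
  "(\<integral>\<^sup>+t. ennreal (ball_volume_sq n (s - t\<^sup>2)) \<partial>lborel) = ennreal (ball_volume_sq (Suc n) s)"
proof (cases "s > 0")
  case False
  then have "s - t\<^sup>2 \<le> 0" for t
    by (smt (verit) zero_le_power2)
  then show ?thesis using False by simp
next
  case True
  define r where "r = sqrt s"
  have r: "r > 0" "s = r\<^sup>2" using True by (auto simp: r_def)
  have "(\<integral>\<^sup>+t. ennreal (ball_volume_sq n (s - t\<^sup>2)) \<partial>lborel)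
      = r * (\<integral>\<^sup>+t. ennreal (ball_volume_sq n (s - (r * t)\<^sup>2)) \<partial>lborel)"
    using r by (subst nn_integral_real_affine[where c = r and t = 0]) auto
  also have "(\<lambda>t. ball_volume_sq n (s - (r * t)\<^sup>2)) = (\<lambda>t. r ^ n * ball_volume_sq n (1 - t\<^sup>2))"
    by (simp add: ball_volume_sq_scale[OF r(1), symmetric] r(2) power_mult_distrib right_diff_distrib)
  also have "(\<integral>\<^sup>+t. ennreal (r ^ n * ball_volume_sq n (1 - t\<^sup>2)) \<partial>lborel)
      = (\<integral>\<^sup>+t. ennreal (r ^ n * unit_ball_vol n) * ennreal (indicator {-1..1} t * sqrt (1 - t\<^sup>2) ^ n) \<partial>lborel)"
  proof (intro nn_integral_cong_AE)
    have "AE t::real in lborel. t \<notin> {-1,1}"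
      by (intro AE_not_in countable_imp_null_set_lborel) auto
    then show "AE t in lborel. ennreal (r ^ n * ball_volume_sq n (1 - t\<^sup>2)) =
        ennreal (r ^ n * unit_ball_vol n) * ennreal (indicator {-1..1} t * sqrt (1 - t\<^sup>2) ^ n)"
    proof eventually_elim
      case (elim t)
      show ?case
      proof (cases "\<bar>t\<bar> < 1")
        case True
        then have "t\<^sup>2 < 1" by (simp add: abs_square_less_1)
        moreover have "indicator {-1..1} t = (1::real)" using True by (auto simp: indicator_def)
        ultimately show ?thesis using r
          by (auto simp: ball_volume_sq_def ennreal_mult'[symmetric] mult_ac)
      next
        case False
        then have "1 - t\<^sup>2 \<le> 0" "t \<notin> {-1..1}" using elim
          by (auto simp: abs_square_less_1 not_less[symmetric])
        then show ?thesis by simp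
      qed
    qed
  qed
  also have "\<dots> = ennreal (r ^ n * unit_ball_vol n * Beta (1 / 2) (real n / 2 + 1))"
    using r by (subst nn_integral_cmult)
      (auto simp: emeasure_cball_aux_integral ennreal_mult'[symmetric])
  also have "ennreal r * \<dots> = ennreal (unit_ball_vol (real (Suc n)) * r ^ Suc n)"
    unfolding unit_ball_vol_Suc_Beta[symmetric]
    using r by (simp add: ennreal_mult'[symmetric] mult_ac)
  also have "\<dots> = ennreal (ball_volume_sq (Suc n) s)"
    using r by (simp add: ball_volume_sq_def)
  finally show ?thesis .
qed

lemma nn_integral_PiM_ball_volume_sq:
  assumes "finite A"
  shows "(\<integral>\<^sup>+f. ennreal (ball_volume_sq n (s - (\<Sum>i\<in>A. (f i)\<^sup>2))) \<partial>Pi\<^sub>M A (\<lambda>_. lborel))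
       = ennreal (ball_volume_sq (n + card A) s)"
  using assms
proof (induction arbitrary: s)
  case empty
  show ?case by (simp add: PiM_empty)
next
  case (insert i A)
  interpret product_sigma_finite "\<lambda>_. lborel :: real measure"
    by standard
  have "(\<integral>\<^sup>+f. ennreal (ball_volume_sq n (s - (\<Sum>i\<in>insert i A. (f i)\<^sup>2))) \<partial>Pi\<^sub>M (insert i A) (\<lambda>_. lborel))
     = (\<integral>\<^sup>+t. \<integral>\<^sup>+f. ennreal (ball_volume_sq n (s - (\<Sum>j\<in>insert i A. ((f(i := t)) j)\<^sup>2)))
          \<partial>Pi\<^sub>M A (\<lambda>_. lborel) \<partial>lborel)"
    using insert.hyps by (subst product_nn_integral_insert_rev) auto
  also have "\<dots> = (\<integral>\<^sup>+t. \<integral>\<^sup>+f. ennreal (ball_volume_sq n ((s - t\<^sup>2) - (\<Sum>j\<in>A. (f j)\<^sup>2)))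
          \<partial>Pi\<^sub>M A (\<lambda>_. lborel) \<partial>lborel)"
  proof -
    have "(\<Sum>j\<in>insert i A. ((f(i := t)) j)\<^sup>2) = t\<^sup>2 + (\<Sum>j\<in>A. (f j)\<^sup>2)" for t and f :: "'a \<Rightarrow> real"
      using insert.hyps by (auto intro!: sum.cong)
    then show ?thesis by (simp only: diff_diff_eq)
  qed
  also have "\<dots> = (\<integral>\<^sup>+t. ennreal (ball_volume_sq (n + card A) (s - t\<^sup>2)) \<partial>lborel)"
    by (simp only: insert.IH)
  also have "\<dots> = ennreal (ball_volume_sq (n + card (insert i A)) s)"
    using insert.hyps by (simp add: nn_integral_ball_volume_sq)
  finally show ?case .
qed

text \<open>
  Fubini's theorem: the coordinate along \<open>b\<close> is kept, and all the others are integrated out by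
  the previous lemma, each of them raising the dimension of the ball by one.
\<close>

lemma nn_integral_ball_volume_sq_axis:
  fixes b :: "'a::euclidean_space"
  assumes b: "b \<in> Basis" and [measurable]: "\<psi> \<in> borel_measurable borel"
  shows "(\<integral>\<^sup>+y. ennreal (ball_volume_sq n (s - (norm y)\<^sup>2)) * \<psi> (y \<bullet> b) \<partial>lborel)
       = (\<integral>\<^sup>+t. ennreal (ball_volume_sq (n + DIM('a) - 1) (s - t\<^sup>2)) * \<psi> t \<partial>lborel)"
proof -
  interpret product_sigma_finite "\<lambda>_. lborel :: real measure"
    by standard
  define A where "A = Basis - {b}"
  have A: "insert b A = Basis" "finite A" "b \<notin> A" using b by (auto simp: A_def)
  have cA: "n + card A = n + DIM('a) - 1"
    using b DIM_positive[where 'a = 'a] by (simp add: A_def)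
  have sq: "(norm (\<Sum>b\<in>Basis. f b *\<^sub>R b :: 'a))\<^sup>2 = (\<Sum>b\<in>Basis. (f b)\<^sup>2)" for f
    by (subst norm_sum_Pythagorean) (auto simp: pairwise_def orthogonal_def inner_Basis)
  have co: "(\<Sum>b\<in>Basis. f b *\<^sub>R b :: 'a) \<bullet> b = f b" for f
    using b by (simp add: inner_sum_left_Basis)
  have sum_meas: "(\<lambda>f. \<Sum>b\<in>Basis. f b *\<^sub>R b :: 'a) \<in> borel_measurable (Pi\<^sub>M Basis (\<lambda>_. lborel))"
    by measurable
  have meas: "(\<lambda>f. ennreal (ball_volume_sq n (s - (\<Sum>b\<in>insert b A. (f b)\<^sup>2))) * \<psi> (f b))
      \<in> borel_measurable (Pi\<^sub>M (insert b A) (\<lambda>_. lborel))"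
    by measurable
  have "(\<integral>\<^sup>+y. ennreal (ball_volume_sq n (s - (norm y)\<^sup>2)) * \<psi> (y \<bullet> b) \<partial>lborel)
     = (\<integral>\<^sup>+f. ennreal (ball_volume_sq n (s - (\<Sum>b\<in>Basis. (f b)\<^sup>2))) * \<psi> (f b) \<partial>Pi\<^sub>M (Basis :: 'a set) (\<lambda>_. lborel))"
    by (subst lborel_eq, subst nn_integral_distr[OF sum_meas]) (measurable, simp add: sq co)
  also have "\<dots> = (\<integral>\<^sup>+f. ennreal (ball_volume_sq n (s - (\<Sum>b\<in>insert b A. (f b)\<^sup>2))) * \<psi> (f b) \<partial>Pi\<^sub>M (insert b A) (\<lambda>_. lborel))"
    unfolding A(1) ..
  also have "\<dots> = (\<integral>\<^sup>+t. \<integral>\<^sup>+f. ennreal (ball_volume_sq n (s - (\<Sum>j\<in>insert b A. ((f(b := t)) j)\<^sup>2))) * \<psi> ((f(b := t)) b)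
          \<partial>Pi\<^sub>M A (\<lambda>_. lborel) \<partial>lborel)"
    by (rule product_nn_integral_insert_rev[OF A(2,3) meas])
  also have "\<dots> = (\<integral>\<^sup>+t. \<integral>\<^sup>+f. ennreal (ball_volume_sq n ((s - t\<^sup>2) - (\<Sum>j\<in>A. (f j)\<^sup>2))) * \<psi> t
          \<partial>Pi\<^sub>M A (\<lambda>_. lborel) \<partial>lborel)"
  proof -
    have "(\<Sum>j\<in>insert b A. ((f(b := t)) j)\<^sup>2) = t\<^sup>2 + (\<Sum>j\<in>A. (f j)\<^sup>2)" for t and f :: "'a \<Rightarrow> real"
      using A(2,3) by (auto intro!: sum.cong)
    then show ?thesis by (simp only: diff_diff_eq fun_upd_same)
  qed
  also have "\<dots> = (\<integral>\<^sup>+t. ennreal (ball_volume_sq (n + DIM('a) - 1) (s - t\<^sup>2)) * \<psi> t \<partial>lborel)"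
    using A(2) by (simp add: nn_integral_multc nn_integral_PiM_ball_volume_sq cA)
  finally show ?thesis .
qed

lemma nn_integral_lborel_translate:
  fixes g :: "'a::euclidean_space \<Rightarrow> ennreal"
  assumes [measurable]: "g \<in> borel_measurable borel"
  shows "(\<integral>\<^sup>+x. g (a + x) \<partial>lborel) = (\<integral>\<^sup>+x. g x \<partial>lborel)"
proof -
  have "(\<integral>\<^sup>+x. g x \<partial>lborel) = (\<integral>\<^sup>+x. g x \<partial>distr lborel borel (\<lambda>x. a + x))"
    using lborel_affine[of 1 a] by (simp add: density_1)
  then show ?thesis by (simp add: nn_integral_distr)
qed

lemma nn_integral_lborel_reflect:
  fixes g :: "'a::euclidean_space \<Rightarrow> ennreal"
  assumes [measurable]: "g \<in> borel_measurable borel"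
  shows "(\<integral>\<^sup>+x. g (a - x) \<partial>lborel) = (\<integral>\<^sup>+x. g x \<partial>lborel)"
proof -
  have "(\<integral>\<^sup>+x. g x \<partial>lborel) = (\<integral>\<^sup>+x. g x \<partial>distr lborel borel (\<lambda>x. a + (- 1) *\<^sub>R x))"
    using lborel_affine[of "-1" a] by (simp add: density_1)
  also have "\<dots> = (\<integral>\<^sup>+x. g (a + (- 1) *\<^sub>R x) \<partial>lborel)"
    by (rule nn_integral_distr) simp_all
  finally show ?thesis by simp
qed

text \<open>
  The proof evaluates the double integral of \<open>g (T x + y) b y\<close>, where \<open>b\<close> is the indicator
  function of the unit ball, in both orders. For fixed \<open>y\<close> the shift by \<open>y\<close> is absorbed by
  translation invariance in \<open>x\<close>; for fixed \<open>x\<close> the substitution \<open>y \<leftarrow> y - T x\<close> isolates the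
  integral of \<open>g\<close>. In both cases the volume of the ball splits off, as \<open>T\<close> preserves the ball.
\<close>

lemma nn_integral_lborel_orthogonal_transformation:
  fixes T :: "'a::euclidean_space \<Rightarrow> 'a" and g :: "'a \<Rightarrow> ennreal"
  assumes T: "orthogonal_transformation T" and [measurable]: "g \<in> borel_measurable borel"
  shows "(\<integral>\<^sup>+x. g (T x) \<partial>lborel) = (\<integral>\<^sup>+x. g x \<partial>lborel)"
proof -
  have lin: "linear T" using T by (rule orthogonal_transformation_linear)
  have [measurable]: "T \<in> borel_measurable borel"
    using lin by (simp add: borel_measurable_continuous_onI linear_continuous_on linear_conv_bounded_linear)
  have surj: "surj T" using T by (rule orthogonal_transformation_surj)
  let ?b = "indicator (ball 0 1) :: 'a \<Rightarrow> ennreal"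
  let ?v = "emeasure lborel (ball (0::'a) 1)"
  have [measurable]: "ball (0::'a) 1 \<in> sets borel" by simp
  have [simp]: "?b (T x) = ?b x" for x
    using T by (simp add: indicator_def orthogonal_transformation_norm)
  have 1: "(\<integral>\<^sup>+x. g (T x + y) \<partial>lborel) = (\<integral>\<^sup>+x. g (T x) \<partial>lborel)" for y
  proof -
    obtain z where z: "y = T z" using surj by (metis surjD)
    have "(\<integral>\<^sup>+x. g (T x + y) \<partial>lborel) = (\<integral>\<^sup>+x. g (T (z + x)) \<partial>lborel)"
      using lin by (simp add: z linear_add add.commute)
    also have "\<dots> = (\<integral>\<^sup>+x. g (T x) \<partial>lborel)"
      by (rule nn_integral_lborel_translate[where g = "\<lambda>x. g (T x)"]) measurable
    finally show ?thesis .
  qed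
  have 2: "(\<integral>\<^sup>+x. ?b (y - T x) \<partial>lborel) = ?v" for y
  proof -
    obtain z where z: "y = T z" using surj by (metis surjD)
    have "(\<integral>\<^sup>+x. ?b (y - T x) \<partial>lborel) = (\<integral>\<^sup>+x. ?b (T (z - x)) \<partial>lborel)"
      using lin by (simp only: z linear_diff)
    also have "\<dots> = (\<integral>\<^sup>+x. ?b (z - x) \<partial>lborel)" by simp
    also have "\<dots> = (\<integral>\<^sup>+x. ?b x \<partial>lborel)"
      by (rule nn_integral_lborel_reflect) measurable
    finally show ?thesis by simp
  qed
  have "?v * (\<integral>\<^sup>+x. g (T x) \<partial>lborel) = (\<integral>\<^sup>+y. (\<integral>\<^sup>+x. g (T x + y) \<partial>lborel) * ?b y \<partial>lborel)"
    by (subst mult.commute) (simp add: 1 nn_integral_cmult)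
  also have "\<dots> = (\<integral>\<^sup>+y. (\<integral>\<^sup>+x. g (T x + y) * ?b y \<partial>lborel) \<partial>lborel)"
    by (simp add: nn_integral_multc)
  also have "\<dots> = (\<integral>\<^sup>+x. (\<integral>\<^sup>+y. g (T x + y) * ?b y \<partial>lborel) \<partial>lborel)"
    by (rule lborel_pair.Fubini'[symmetric]) measurable
  also have "\<dots> = (\<integral>\<^sup>+x. (\<integral>\<^sup>+y. g y * ?b (y - T x) \<partial>lborel) \<partial>lborel)"
  proof (rule nn_integral_cong)
    fix x
    have "(\<integral>\<^sup>+y. g (T x + y) * ?b (T x + y - T x) \<partial>lborel) = (\<integral>\<^sup>+y. g y * ?b (y - T x) \<partial>lborel)"
      by (rule nn_integral_lborel_translate[where g = "\<lambda>y. g y * ?b (y - T x)"]) measurable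
    then show "(\<integral>\<^sup>+y. g (T x + y) * ?b y \<partial>lborel) = (\<integral>\<^sup>+y. g y * ?b (y - T x) \<partial>lborel)" by simp
  qed
  also have "\<dots> = (\<integral>\<^sup>+y. (\<integral>\<^sup>+x. g y * ?b (y - T x) \<partial>lborel) \<partial>lborel)"
    by (rule lborel_pair.Fubini') measurable
  also have "\<dots> = (\<integral>\<^sup>+y. g y * ?v \<partial>lborel)"
    by (simp add: nn_integral_cmult 2)
  also have "\<dots> = ?v * (\<integral>\<^sup>+x. g x \<partial>lborel)"
    by (simp add: nn_integral_multc mult.commute)
  finally have "?v * (\<integral>\<^sup>+x. g (T x) \<partial>lborel) = ?v * (\<integral>\<^sup>+x. g x \<partial>lborel)" .
  moreover have "?v \<noteq> 0" "?v \<noteq> top"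
    by (auto simp: emeasure_ball less_imp_neq[symmetric])
  ultimately show ?thesis by (simp add: ennreal_mult_cancel_left)
qed

text \<open>
  The density is radial, so a rotation reduces an arbitrary direction \<open>u\<close> to a coordinate axis.
\<close>

lemma nn_integral_ball_volume_sq_slice:
  fixes u :: "real ^ 'k::finite"
  assumes u: "norm u = 1" and [measurable]: "\<psi> \<in> borel_measurable borel"
  shows "(\<integral>\<^sup>+y. ennreal (ball_volume_sq n (s - (norm y)\<^sup>2)) * \<psi> (y \<bullet> u) \<partial>lborel)
       = (\<integral>\<^sup>+t. ennreal (ball_volume_sq (n + CARD('k) - 1) (s - t\<^sup>2)) * \<psi> t \<partial>lborel)"
proof -
  obtain e :: "real ^ 'k" where e: "e \<in> Basis" by (meson nonempty_Basis ex_in_conv)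
  obtain T where T: "orthogonal_transformation T" and Te: "T e = u"
    using orthogonal_transformation_exists_1[of e u] e u by auto
  have [measurable]: "T \<in> borel_measurable borel"
    using orthogonal_transformation_linear[OF T]
    by (simp add: borel_measurable_continuous_onI linear_continuous_on linear_conv_bounded_linear)
  have "(\<integral>\<^sup>+y. ennreal (ball_volume_sq n (s - (norm y)\<^sup>2)) * \<psi> (y \<bullet> u) \<partial>lborel)
      = (\<integral>\<^sup>+y. ennreal (ball_volume_sq n (s - (norm (T y))\<^sup>2)) * \<psi> (T y \<bullet> u) \<partial>lborel)"
    by (rule nn_integral_lborel_orthogonal_transformation[OF T, symmetric]) measurable
  also have "\<dots> = (\<integral>\<^sup>+y. ennreal (ball_volume_sq n (s - (norm y)\<^sup>2)) * \<psi> (y \<bullet> e) \<partial>lborel)"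
    using T unfolding Te[symmetric]
    by (simp add: orthogonal_transformation_norm orthogonal_transformation_def)
  also have "\<dots> = (\<integral>\<^sup>+t. ennreal (ball_volume_sq (n + DIM(real^'k) - 1) (s - t\<^sup>2)) * \<psi> t \<partial>lborel)"
    by (rule nn_integral_ball_volume_sq_axis[OF e]) measurable
  finally show ?thesis by simp
qed

section \<open>Asymptotics of the Bessel integral\<close>

lemma continuous_on_csqrt_right_halfplane: "continuous_on {w. 0 \<le> Re w} csqrt"
proof (clarsimp simp: continuous_on_eq_continuous_within)
  fix w :: complex assume w: "0 \<le> Re w"
  show "continuous (at w within {w. 0 \<le> Re w}) csqrt"
  proof (cases "w = 0")
    case True
    have "((\<lambda>x. sqrt (norm x)) \<longlongrightarrow> sqrt (norm (0::complex))) (at 0 within {w. 0 \<le> Re w})"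
      by (intro tendsto_intros)
    then have "(csqrt \<longlongrightarrow> 0) (at 0 within {w. 0 \<le> Re w})"
      by (subst tendsto_norm_zero_iff[symmetric]) simp
    then show ?thesis by (simp add: continuous_within True)
  next
    case False
    with w have "w \<notin> \<real>\<^sub>\<le>\<^sub>0"
      by (auto simp: complex_nonpos_Reals_iff complex_eq_iff)
    then show ?thesis by (rule continuous_within_csqrt)
  qed
qed

lemma cnj_csqrt_right_halfplane:
  assumes "0 \<le> Re w" shows "cnj (csqrt w) = csqrt (cnj w)"
proof (cases "w = 0")
  case False
  with assms have "w \<notin> \<real>\<^sub>\<le>\<^sub>0"
    by (auto simp: complex_nonpos_Reals_iff complex_eq_iff)
  then show ?thesis by (rule cnj_csqrt)
qed simp

lemma csqrt_of_real_mult_left: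
  assumes "0 \<le> r"
  shows "csqrt (of_real r * w) = of_real (sqrt r) * csqrt w"
proof (cases "r = 0")
  case False
  then have "r > 0" using assms by simp
  then show ?thesis
    using csqrt_principal[of w]
    by (intro csqrt_unique) (auto simp: power_mult_distrib simp flip: of_real_power)
qed simp

text \<open>
  Poisson's integral: for \<open>z > 0\<close> and \<open>\<nu> = (n + 1) / 2\<close> this is
  \<open>sqrt \<pi> \<Gamma>(n/2 + 1) (z/2)\<^bsup>-\<nu>\<^esup> J\<^sub>\<nu> z\<close>, where \<open>J\<^sub>\<nu>\<close> is the Bessel function.
\<close>

definition bessel_integral :: "nat \<Rightarrow> real \<Rightarrow> real" where
  "bessel_integral n z = integral {-1..1} (\<lambda>t. sqrt (1 - t\<^sup>2) ^ n * cos (z * t))"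

text \<open>
  The integral of \<open>exp (\<i> z w) (1 - w\<^sup>2)\<^bsup>n/2\<^esup>\<close> along the vertical segment \<open>w = 1 + \<i> v / z\<close> from \<open>1\<close> to
  \<open>1 + \<i>\<close>, stripped of the factors \<open>exp (\<i> z)\<close>, \<open>z\<^bsup>-n/2\<^esup>\<close> and \<open>dw/dv = \<i> / z\<close>. In this scaling it
  converges as \<open>z\<close> grows.
\<close>

definition edge_integral :: "nat \<Rightarrow> real \<Rightarrow> complex" where
  "edge_integral n z = integral {0..z} (\<lambda>v. of_real (exp (- v)) * csqrt (of_real (v\<^sup>2 / z) - 2 * \<i> * of_real v) ^ n)"

lemma integral_segment_primitive:
  fixes F f :: "complex \<Rightarrow> complex"
  assumes F: "\<And>w. w \<in> S \<Longrightarrow> (F has_field_derivative f w) (at w within S)"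
    and S: "\<And>t. t \<in> {l..u} \<Longrightarrow> a + of_real t * c \<in> S" and "l \<le> u"
  shows "((\<lambda>t. c * f (a + of_real t * c)) has_integral F (a + of_real u * c) - F (a + of_real l * c)) {l..u}"
proof (rule fundamental_theorem_of_calculus[OF \<open>l \<le> u\<close>])
  fix t assume t: "t \<in> {l..u}"
  have 1: "((\<lambda>t. a + of_real t * c) has_vector_derivative c) (at t within {l..u})"
    by (auto intro!: derivative_eq_intros)
  have 2: "(F has_field_derivative f (a + of_real t * c)) (at (a + of_real t * c) within (\<lambda>t. a + of_real t * c) ` {l..u})"
    using F[OF S[OF t]] by (rule DERIV_subset) (use S in auto)
  from field_vector_diff_chain_within[OF 1 2]
  show "((\<lambda>t. F (a + of_real t * c)) has_vector_derivative c * f (a + of_real t * c)) (at t within {l..u})"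
    by (simp add: o_def)
qed

text \<open>
  Cauchy's theorem on the rectangle with the corners \<open>\<plusminus>1\<close> and \<open>\<plusminus>1 + \<i>\<close>. The closed right half plane contains
  \<open>1 - w\<^sup>2\<close> for all \<open>w\<close> in the rectangle, so the principal square root is continuous up to the
  branch points \<open>\<plusminus>1\<close>. The reflection in the imaginary axis exchanges the two vertical edges
  and conjugates the integrand; together they contribute twice an imaginary part. On the top
  edge the integrand is of size \<open>exp (-z)\<close>.
\<close>

lemma bessel_integral_edges:
  assumes z: "z > 0"
  shows "\<bar>sqrt z ^ (n + 2) * bessel_integral n z - 2 * Im (exp (\<i> * of_real z) * edge_integral n z)\<bar>
       \<le> 2 * 3 ^ n * (sqrt z ^ (n + 2) * exp (- z))"
proof -
  define f where "f w = exp (\<i> * of_real z * w) * csqrt (1 - w\<^sup>2) ^ n" for w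
  define S where "S = {w. -1 \<le> Re w \<and> Re w \<le> 1 \<and> 0 \<le> Im w \<and> Im w \<le> 1}"
  have S_eq: "S = cbox (-1) (1 + \<i>)"
    by (auto simp: S_def cbox_def Basis_complex_def inner_complex_def)
  have Re_pos: "0 \<le> Re (1 - w\<^sup>2)" if "w \<in> S" for w
  proof -
    have "(Re w)\<^sup>2 \<le> 1" using that by (auto simp: S_def abs_square_le_1)
    then show ?thesis
      unfolding minus_complex.sel one_complex.sel Re_power2 using zero_le_power2[of "Im w"] by linarith
  qed
  have cont: "continuous_on S f"
    unfolding f_def
    by (intro continuous_intros continuous_on_compose2[OF continuous_on_csqrt_right_halfplane])
       (use Re_pos in auto)
  have diff: "f field_differentiable at w" if w: "w \<in> interior S - {}" for w
  proof -
    have int: "interior S = box (-1) (1 + \<i>)" unfolding S_eq by (rule interior_cbox)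
    have "1 - w\<^sup>2 \<notin> \<real>\<^sub>\<le>\<^sub>0" if "w \<in> interior S" for w
    proof -
      have "-1 < Re w" "Re w < 1"
        using that unfolding int by (auto simp: box_def Basis_complex_def inner_complex_def)
      then have "(Re w)\<^sup>2 < 1" by (auto simp: abs_square_less_1)
      then have "0 < Re (1 - w\<^sup>2)"
        unfolding minus_complex.sel one_complex.sel Re_power2
        using zero_le_power2[of "Im w"] by linarith
      then show ?thesis by (auto simp: complex_nonpos_Reals_iff)
    qed
    then have "f holomorphic_on interior S"
      unfolding f_def by (intro holomorphic_intros)
    with w show ?thesis
      by (intro holomorphic_on_imp_differentiable_at[OF _ open_interior]) auto
  qed
  \<comment> \<open>A primitive of \<open>f\<close> on the rectangle; the integrals along the four edges are differences of its values.\<close>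
  obtain F where F: "\<And>w. w \<in> S \<Longrightarrow> (F has_field_derivative f w) (at w within S)"
    using holomorphic_convex_primitive[OF _ _ cont diff] unfolding S_eq by auto
  have bottom: "((\<lambda>t. f (of_real t)) has_integral F 1 - F (- 1)) {-1..1}"
    using integral_segment_primitive[OF F, where a = 0 and c = 1 and l = "-1" and u = 1]
    by (simp add: S_def)
  have top: "((\<lambda>t. f (\<i> + of_real t)) has_integral F (\<i> + 1) - F (\<i> - 1)) {-1..1}"
    using integral_segment_primitive[OF F, where a = \<i> and c = 1 and l = "-1" and u = 1]
    by (simp add: S_def)
  have right: "((\<lambda>v. \<i> / of_real z * f (1 + of_real v * (\<i> / of_real z))) has_integral F (1 + \<i>) - F 1) {0..z}"
    using integral_segment_primitive[OF F, where a = 1 and c = "\<i> / of_real z" and l = 0 and u = z] z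
    by (simp add: S_def)
  have left: "((\<lambda>v. \<i> / of_real z * f (- 1 + of_real v * (\<i> / of_real z))) has_integral F (- 1 + \<i>) - F (- 1)) {0..z}"
    using integral_segment_primitive[OF F, where a = "-1" and c = "\<i> / of_real z" and l = 0 and u = z] z
    by (simp add: S_def)
  define K where "K = of_real (1 / sqrt z ^ n) * exp (\<i> * of_real z) * edge_integral n z"
  let ?e = "\<lambda>v. of_real (exp (- v)) * csqrt (of_real (v\<^sup>2 / z) - 2 * \<i> * of_real v) ^ n"
  have f_right: "f (1 + of_real v * (\<i> / of_real z)) = of_real (1 / sqrt z ^ n) * exp (\<i> * of_real z) * ?e v" for v
  proof -
    have "1 - (1 + of_real v * (\<i> / of_real z))\<^sup>2 = of_real (1 / z) * (of_real (v\<^sup>2 / z) - 2 * \<i> * of_real v)"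
      using z by (simp add: power2_eq_square field_simps)
    moreover have "exp (\<i> * of_real z * (1 + of_real v * (\<i> / of_real z))) = exp (\<i> * of_real z) * of_real (exp (- v))"
      using z by (simp add: algebra_simps exp_add[symmetric] exp_of_real[symmetric])
    moreover have "csqrt (of_real (1 / z) * (of_real (v\<^sup>2 / z) - 2 * \<i> * of_real v)) ^ n
       = of_real (1 / sqrt z ^ n) * csqrt (of_real (v\<^sup>2 / z) - 2 * \<i> * of_real v) ^ n"
      by (subst csqrt_of_real_mult_left) (use z in \<open>simp_all add: power_mult_distrib power_divide real_sqrt_divide power_one_over\<close>)
    ultimately show ?thesis by (simp add: f_def)
  qed
  \<comment> \<open>Reflection in the imaginary axis, which maps the right edge to the left edge.\<close>
  have f_cnj: "f (- cnj w) = cnj (f w)" if "w \<in> S" for w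
  proof -
    have "cnj (csqrt (1 - w\<^sup>2)) = csqrt (cnj (1 - w\<^sup>2))"
      using that Re_pos by (intro cnj_csqrt_right_halfplane)
    moreover have "exp (\<i> * of_real z * (- cnj w)) = cnj (exp (\<i> * of_real z * w))"
      by (simp add: exp_cnj)
    ultimately show ?thesis unfolding f_def by simp
  qed
  have f_left: "f (- 1 + of_real v * (\<i> / of_real z)) = cnj (f (1 + of_real v * (\<i> / of_real z)))" if "v \<in> {0..z}" for v
    using f_cnj[of "1 + of_real v * (\<i> / of_real z)"] that z by (simp add: S_def)
  have edge: "(?e has_integral edge_integral n z) {0..z}"
  proof -
    have "continuous_on {0..z} ?e" using z
      by (intro continuous_intros continuous_on_compose2[OF continuous_on_csqrt_right_halfplane]) auto
    then show ?thesis unfolding edge_integral_def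
      by (intro integrable_integral integrable_continuous_interval)
  qed
  then have K: "((\<lambda>v. f (1 + of_real v * (\<i> / of_real z))) has_integral K) {0..z}"
    unfolding f_right K_def by (rule has_integral_mult_right)
  have "((\<lambda>v. cnj (f (1 + of_real v * (\<i> / of_real z)))) has_integral cnj K) {0..z}"
    using has_integral_linear[OF K bounded_linear_cnj] by (simp add: o_def)
  then have "((\<lambda>v. f (- 1 + of_real v * (\<i> / of_real z))) has_integral cnj K) {0..z}"
    by (rule has_integral_eq[rotated]) (rule f_left[symmetric])
  from has_integral_unique[OF has_integral_mult_right[OF this] left]
  have left': "F (- 1 + \<i>) - F (- 1) = \<i> / of_real z * cnj K" by simp
  from has_integral_unique[OF has_integral_mult_right[OF K] right]
  have right': "F (1 + \<i>) - F 1 = \<i> / of_real z * K" by simp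
  have "norm (F (\<i> + 1) - F (\<i> - 1)) \<le> exp (- z) * 3 ^ n * measure lborel (cbox (-1) (1::real))"
  proof (rule has_integral_bound)
    show "((\<lambda>t. f (\<i> + of_real t)) has_integral F (\<i> + 1) - F (\<i> - 1)) (cbox (-1) 1)"
      using top by simp
    fix t :: real assume "t \<in> cbox (-1) 1"
    then have t: "\<bar>t\<bar> \<le> 1" by auto
    have "norm (1 - (\<i> + of_real t)\<^sup>2) \<le> norm (1::complex) + norm ((\<i> + of_real t)\<^sup>2)"
      by (rule norm_triangle_ineq4)
    also have "norm ((\<i> + of_real t)\<^sup>2) \<le> (1 + 1)\<^sup>2"
      unfolding norm_power using t
      by (intro power_mono order_trans[OF norm_triangle_ineq]) auto
    finally have "sqrt (norm (1 - (\<i> + of_real t)\<^sup>2)) \<le> sqrt (3\<^sup>2)"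
      by (intro real_sqrt_le_mono) simp
    then have "norm (csqrt (1 - (\<i> + of_real t)\<^sup>2) ^ n) \<le> 3 ^ n"
      unfolding norm_power norm_csqrt by (intro power_mono) auto
    then show "norm (f (\<i> + of_real t)) \<le> exp (- z) * 3 ^ n"
      by (simp add: f_def norm_mult norm_exp_eq_Re)
  qed simp
  then have top_bound: "norm (F (\<i> + 1) - F (\<i> - 1)) \<le> 2 * 3 ^ n * exp (- z)" by (simp add: mult_ac)
  have "F 1 - F (- 1) = (F (\<i> + 1) - F (\<i> - 1)) + \<i> / of_real z * (cnj K - K)"
  proof -
    have "F 1 - F (- 1) = (F (\<i> + 1) - F (\<i> - 1)) + ((F (- 1 + \<i>) - F (- 1)) - (F (1 + \<i>) - F 1))"
      by (simp add: add.commute)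
    then show ?thesis unfolding left' right' by (simp only: right_diff_distrib)
  qed
  also have "\<i> / of_real z * (cnj K - K) = of_real (2 * Im K / z)"
    by (simp add: complex_eq_iff)
  finally have F1: "Re (F 1 - F (- 1)) = Re (F (\<i> + 1) - F (\<i> - 1)) + 2 * Im K / z" by simp
  have "((\<lambda>t. Re (f (of_real t))) has_integral Re (F 1 - F (- 1))) {-1..1}"
    using has_integral_linear[OF bottom bounded_linear_Re] by (simp add: o_def)
  moreover have "Re (f (of_real t)) = sqrt (1 - t\<^sup>2) ^ n * cos (z * t)" if "t \<in> {-1..1}" for t
  proof -
    have "t\<^sup>2 \<le> 1" using that by (auto simp: abs_square_le_1)
    then have "csqrt (1 - (of_real t)\<^sup>2) = of_real (sqrt (1 - t\<^sup>2))"
      using csqrt_of_real[of "1 - t\<^sup>2"] by simp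
    then show ?thesis
      unfolding f_def by (simp add: Re_exp mult.commute flip: of_real_power of_real_mult)
  qed
  ultimately have "((\<lambda>t. sqrt (1 - t\<^sup>2) ^ n * cos (z * t)) has_integral Re (F 1 - F (- 1))) {-1..1}"
    by (rule has_integral_eq[rotated]) auto
  then have I: "bessel_integral n z = Re (F (\<i> + 1) - F (\<i> - 1)) + 2 * Im K / z"
    unfolding bessel_integral_def F1[symmetric] by (rule integral_unique)
  have ImK: "Im K = Im (exp (\<i> * of_real z) * edge_integral n z) / sqrt z ^ n"
  proof -
    have "Im (of_real r * w) = r * Im w" for r w by simp
    then show ?thesis unfolding K_def mult.assoc by simp
  qed
  have "sqrt z ^ (n + 2) * bessel_integral n z - 2 * Im (exp (\<i> * of_real z) * edge_integral n z)
      = sqrt z ^ (n + 2) * Re (F (\<i> + 1) - F (\<i> - 1))"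
  proof -
    have sz: "sqrt z ^ (n + 2) = z * sqrt z ^ n" using z by (simp add: power_add)
    have cancel: "sqrt z ^ (n + 2) * (2 * (w / sqrt z ^ n) / z) = 2 * w" for w
      unfolding sz using z by simp
    show ?thesis unfolding I ImK distrib_left cancel by simp
  qed
  moreover have "\<bar>sqrt z ^ (n + 2) * Re (F (\<i> + 1) - F (\<i> - 1))\<bar> \<le> sqrt z ^ (n + 2) * (2 * 3 ^ n * exp (- z))"
    unfolding abs_mult
    using order_trans[OF abs_Re_le_cmod top_bound] z by (intro mult_mono) auto
  ultimately show ?thesis by (simp add: mult_ac)
qed

lemma power_div_fact_le_exp:
  assumes "x \<ge> (0::real)"
  shows "x ^ n / fact n \<le> exp x"
proof -
  have "(\<Sum>k\<in>{n}. x ^ k /\<^sub>R fact k) \<le> (\<Sum>k. x ^ k /\<^sub>R fact k)"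
    by (rule sum_le_suminf[OF summable_exp_generic]) (use assms in auto)
  also have "\<dots> = exp x" by (simp only: exp_def)
  finally show ?thesis by (simp add: divide_inverse_commute)
qed

text \<open>
  The integrable majorant for the limit of \<open>edge_integral\<close>.
\<close>

lemma power_mult_exp_minus_le:
  assumes "v \<ge> (0::real)"
  shows "exp (- v) * (v + 1) ^ n \<le> fact n * 2 ^ n * exp (1/2) * exp (- (1/2) * v)"
proof -
  have "((v + 1) / 2) ^ n / fact n \<le> exp ((v + 1) / 2)"
    using assms by (intro power_div_fact_le_exp) simp
  then have "(v + 1) ^ n \<le> exp ((v + 1) / 2) * (2 ^ n * fact n)"
    unfolding power_divide divide_divide_eq_left by (subst (asm) pos_divide_le_eq) simp_all
  then have "exp (- v) * (v + 1) ^ n \<le> exp (- v) * (exp ((v + 1) / 2) * (2 ^ n * fact n))"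
    by (intro mult_left_mono) auto
  also have "exp (- v) * (exp ((v + 1) / 2) * (2 ^ n * fact n)) = (exp (- v) * exp ((v + 1) / 2)) * (2 ^ n * fact n)"
    by (simp only: mult.assoc)
  also have "exp (- v) * exp ((v + 1) / 2) = exp (1/2) * exp (- (1/2) * v)"
    unfolding exp_add[symmetric] by (rule arg_cong[where f = exp]) (simp add: field_simps)
  finally show ?thesis by (simp only: mult_ac)
qed

text \<open>
  As \<open>z\<close> grows, the radicand tends to \<open>-2\<i>v\<close>, whose square root is \<open>sqrt v (1 - \<i>)\<close>, and the integral
  becomes a Gamma integral. Dominated convergence is applied along sequences.
\<close>

lemma edge_integral_limit:
  "(edge_integral n \<longlongrightarrow> of_real (Gamma (real n / 2 + 1)) * (1 - \<i>) ^ n) at_top"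
proof (rule tendsto_at_topI_sequentially)
  fix X :: "nat \<Rightarrow> real" assume X0: "filterlim X at_top sequentially"
  obtain N where N: "\<And>k. k \<ge> N \<Longrightarrow> X k \<ge> 1"
    using X0[unfolded filterlim_at_top, rule_format, of 1] by (auto simp: eventually_sequentially)
  define Y where "Y k = X (k + N)" for k
  have Y1: "Y k \<ge> 1" for k using N by (simp add: Y_def)
  have Y: "filterlim Y at_top sequentially"
    unfolding Y_def by (rule filterlim_compose[OF X0]) (rule filterlim_add_const_nat_at_top)
  let ?e = "\<lambda>z v. of_real (exp (- v)) * csqrt (of_real (v\<^sup>2 / z) - 2 * \<i> * of_real v) ^ n"
  let ?g = "\<lambda>v. of_real (exp (- v)) * csqrt (- 2 * \<i> * of_real v) ^ n"
  let ?h = "\<lambda>v::real. fact n * 2 ^ n * exp (1/2) * exp (- (1/2) * v) :: real"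
  have conv: "(\<lambda>k. integral {0..} (\<lambda>v. if v \<in> {0..Y k} then ?e (Y k) v else 0)) \<longlonglongrightarrow> integral {0..} ?g"
  proof (rule dominated_convergence)
    show "(\<lambda>v. if v \<in> {0..Y k} then ?e (Y k) v else 0) integrable_on {0..}" for k
    proof -
      have "continuous_on {0..Y k} (?e (Y k))"
        using Y1[of k]
        by (intro continuous_intros continuous_on_compose2[OF continuous_on_csqrt_right_halfplane]) auto
      then have "?e (Y k) integrable_on {0..Y k}" by (rule integrable_continuous_interval)
      then show ?thesis unfolding integrable_on_def by (subst has_integral_restrict) auto
    qed
    show "?h integrable_on {0..}"
      by (rule integrable_on_mult_right) (rule integrable_on_exp_minus_to_infinity, simp)
    show "norm (if v \<in> {0..Y k} then ?e (Y k) v else 0) \<le> ?h v" if "v \<in> {0..}" for k v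
    proof (cases "v \<in> {0..Y k}")
      case True
      have "norm (of_real (v\<^sup>2 / Y k) - 2 * \<i> * of_real v) \<le> v\<^sup>2 / Y k + 2 * v"
        using True Y1[of k] by (intro order_trans[OF norm_triangle_ineq4]) (auto simp: norm_mult norm_divide norm_power)
      also have "v\<^sup>2 / Y k \<le> v\<^sup>2 / 1"
        using Y1[of k] by (intro divide_left_mono) auto
      also have "v\<^sup>2 / 1 + 2 * v = v\<^sup>2 + 2 * v" by simp
      also have "\<dots> \<le> (v + 1)\<^sup>2" by (simp add: power2_eq_square algebra_simps)
      finally have "norm (csqrt (of_real (v\<^sup>2 / Y k) - 2 * \<i> * of_real v)) \<le> v + 1"
        using True by (simp add: real_le_lsqrt)
      then have "norm (?e (Y k) v) \<le> exp (- v) * (v + 1) ^ n"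
        unfolding norm_mult norm_power by (intro mult_mono power_mono) auto
      with True show ?thesis using power_mult_exp_minus_le[of v n] by simp
    next
      case False
      show ?thesis unfolding if_not_P[OF False] by simp
    qed
    show "(\<lambda>k. if v \<in> {0..Y k} then ?e (Y k) v else 0) \<longlonglongrightarrow> ?g v" if "v \<in> {0..}" for v
    proof -
      have "(\<lambda>k. v\<^sup>2 / Y k) \<longlonglongrightarrow> 0"
        by (rule tendsto_divide_0[OF tendsto_const filterlim_at_top_imp_at_infinity[OF Y]])
      then have lim: "(\<lambda>k. of_real (v\<^sup>2 / Y k) - 2 * \<i> * of_real v) \<longlonglongrightarrow> of_real 0 - 2 * \<i> * of_real v"
        by (intro tendsto_diff tendsto_of_real tendsto_const)
      have "(\<lambda>k. csqrt (of_real (v\<^sup>2 / Y k) - 2 * \<i> * of_real v)) \<longlonglongrightarrow> csqrt (of_real 0 - 2 * \<i> * of_real v)"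
      proof (rule continuous_on_tendsto_compose[OF continuous_on_csqrt_right_halfplane lim])
        have "0 \<le> v\<^sup>2 / Y k" for k using Y1[of k] by simp
        then show "\<forall>\<^sub>F k in sequentially. of_real (v\<^sup>2 / Y k) - 2 * \<i> * of_real v \<in> {w. 0 \<le> Re w}"
          by (intro always_eventually) simp
      qed simp
      then have "(\<lambda>k. ?e (Y k) v) \<longlonglongrightarrow> ?g v"
        by (intro tendsto_mult tendsto_const tendsto_power) simp
      moreover have "\<forall>\<^sub>F k in sequentially. ?e (Y k) v = (if v \<in> {0..Y k} then ?e (Y k) v else 0)"
        by (rule eventually_mono[OF Y[unfolded filterlim_at_top, rule_format, of v]]) (use that in auto)
      ultimately show ?thesis by (rule Lim_transform_eventually)
    qed
  qed
  have "integral {0..} (\<lambda>v. if v \<in> {0..Y k} then ?e (Y k) v else 0) = edge_integral n (Y k)" for k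
    unfolding edge_integral_def integral_restrict_Int by (simp add: Int_absorb1)
  moreover have "integral {0..} ?g = of_real (Gamma (real n / 2 + 1)) * (1 - \<i>) ^ n"
  proof -
    have sq: "csqrt (- 2 * \<i> * of_real v) = of_real (sqrt v) * (1 - \<i>)" if "v \<ge> 0" for v
    proof -
      have "csqrt (- 2 * \<i>) = 1 - \<i>"
        by (rule csqrt_unique) (simp_all add: power2_eq_square algebra_simps)
      then show ?thesis using csqrt_of_real_mult_left[OF that, of "- 2 * \<i>"] by (simp add: mult_ac)
    qed
    have "((\<lambda>v. v powr (real n / 2) / exp v) has_integral Gamma (real n / 2 + 1)) {0..}"
      using Gamma_integral_real[of "real n / 2 + 1"] by simp
    then have "((\<lambda>v. exp (- v) * sqrt v ^ n) has_integral Gamma (real n / 2 + 1)) {0..}"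
    proof (rule has_integral_spike_finite[of "{0}", rotated 2])
      fix v :: real assume "v \<in> {0..} - {0}"
      then have "v powr (real n / 2) = sqrt v ^ n"
        by (simp add: powr_half_sqrt[symmetric] powr_powr powr_realpow[symmetric])
      then show "exp (- v) * sqrt v ^ n = v powr (real n / 2) / exp v"
        by (simp add: exp_minus field_simps)
    qed simp
    from has_integral_linear[OF this bounded_linear_of_real]
    have "((\<lambda>v. complex_of_real (exp (- v) * sqrt v ^ n) * (1 - \<i>) ^ n) has_integral
        of_real (Gamma (real n / 2 + 1)) * (1 - \<i>) ^ n) {0..}"
      by (intro has_integral_mult_left) (simp add: o_def)
    then have "(?g has_integral of_real (Gamma (real n / 2 + 1)) * (1 - \<i>) ^ n) {0..}"
    proof (rule has_integral_eq[rotated])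
      fix v :: real assume "v \<in> {0..}"
      then show "of_real (exp (- v) * sqrt v ^ n) * (1 - \<i>) ^ n = ?g v"
        by (subst sq) (simp_all add: power_mult_distrib)
    qed
    then show ?thesis by (rule integral_unique)
  qed
  ultimately have "(\<lambda>k. edge_integral n (Y k)) \<longlonglongrightarrow> of_real (Gamma (real n / 2 + 1)) * (1 - \<i>) ^ n"
    using conv by simp
  then show "(\<lambda>k. edge_integral n (X k)) \<longlonglongrightarrow> of_real (Gamma (real n / 2 + 1)) * (1 - \<i>) ^ n"
    unfolding Y_def by (rule LIMSEQ_offset)
qed

lemma Im_exp_times_one_minus_i_power:
  "Im (exp (\<i> * of_real z) * (of_real g * (1 - \<i>) ^ n)) = g * sqrt 2 ^ n * sin (z - real n * pi / 4)"
proof -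
  have "1 - \<i> = of_real (sqrt 2) * exp (\<i> * of_real (- (pi / 4)))"
    by (simp add: complex_eq_iff Re_exp Im_exp cos_45 sin_45)
  then have *: "(1 - \<i>) ^ n = of_real (sqrt 2 ^ n) * exp (\<i> * of_real (- (real n * pi / 4)))"
    by (simp add: power_mult_distrib exp_of_nat_mult[symmetric] mult_ac)
  then have "exp (\<i> * of_real z) * (of_real g * (1 - \<i>) ^ n)
     = of_real (g * sqrt 2 ^ n) * exp (\<i> * of_real (z - real n * pi / 4))"
  proof -
    have "exp (\<i> * of_real (z - real n * pi / 4)) = exp (\<i> * of_real z) * exp (\<i> * of_real (- (real n * pi / 4)))"
      unfolding exp_add[symmetric] by (simp add: algebra_simps)
    with * show ?thesis by (simp only: of_real_mult mult_ac)
  qed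
  moreover have "Im (of_real a * exp (\<i> * of_real b)) = a * sin b" for a b
    by (simp add: Im_exp)
  ultimately show ?thesis by (simp only:)
qed

lemma bessel_integral_asymptotics:
  "((\<lambda>z. sqrt z ^ (n + 2) * bessel_integral n z
       - 2 * Gamma (real n / 2 + 1) * sqrt 2 ^ n * sin (z - real n * pi / 4)) \<longlongrightarrow> 0) at_top"
proof -
  let ?L = "of_real (Gamma (real n / 2 + 1)) * (1 - \<i>) ^ n :: complex"
  have "((\<lambda>z. 2 * 3 ^ n * (sqrt z ^ (n + 2) * exp (- z)) + 2 * norm (edge_integral n z - ?L)) \<longlongrightarrow> 2 * 3 ^ n * 0 + 2 * 0) at_top"
  proof (intro tendsto_intros)
    show "((\<lambda>z. sqrt z ^ (n + 2) * exp (- z)) \<longlongrightarrow> 0) at_top"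
    proof (rule Lim_null_comparison)
      show "\<forall>\<^sub>F z in at_top. norm (sqrt z ^ (n + 2) * exp (- z)) \<le> z ^ (n + 2) / exp z"
        using eventually_ge_at_top[of "1::real"]
      proof eventually_elim
        case (elim z)
        then have "sqrt z \<le> z" by (simp add: sqrt_le_D real_le_lsqrt power2_eq_square)
        then have "sqrt z ^ (n + 2) \<le> z ^ (n + 2)" using elim by (intro power_mono) auto
        then show ?case using elim by (simp add: exp_minus field_simps)
      qed
    qed (rule tendsto_power_div_exp_0)
    show "((\<lambda>z. norm (edge_integral n z - ?L)) \<longlongrightarrow> 0) at_top"
      using edge_integral_limit[of n] by (simp add: LIM_zero tendsto_norm_zero)
  qed
  then have "((\<lambda>z. 2 * 3 ^ n * (sqrt z ^ (n + 2) * exp (- z)) + 2 * norm (edge_integral n z - ?L)) \<longlongrightarrow> 0) at_top"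
    by simp
  then show ?thesis
  proof (rule Lim_null_comparison[rotated])
    show "\<forall>\<^sub>F z in at_top. norm (sqrt z ^ (n + 2) * bessel_integral n z
       - 2 * Gamma (real n / 2 + 1) * sqrt 2 ^ n * sin (z - real n * pi / 4))
       \<le> 2 * 3 ^ n * (sqrt z ^ (n + 2) * exp (- z)) + 2 * norm (edge_integral n z - ?L)"
      using eventually_gt_at_top[of "0::real"]
    proof eventually_elim
      case (elim z)
      let ?E = "edge_integral n z"
      have "\<bar>Im (exp (\<i> * of_real z) * (?E - ?L))\<bar> \<le> norm (exp (\<i> * of_real z) * (?E - ?L))"
        by (rule abs_Im_le_cmod)
      also have "\<dots> = norm (?E - ?L)" by (simp add: norm_mult)
      finally have "\<bar>Im (exp (\<i> * of_real z) * ?E) - Gamma (real n / 2 + 1) * sqrt 2 ^ n * sin (z - real n * pi / 4)\<bar>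
          \<le> norm (?E - ?L)"
        unfolding right_diff_distrib minus_complex.sel Im_exp_times_one_minus_i_power .
      with bessel_integral_edges[OF elim, of n] show ?case
        unfolding real_norm_def by linarith
    qed
  qed
qed

section \<open>Fractional parts of square roots\<close>

text \<open>
  The step from \<open>s\<close> to \<open>s + 1\<close> annihilates the function \<open>x\<^bsup>1-2s\<^esup>\<close> and multiplies every
  \<open>x\<^bsup>1-2i\<^esup>\<close> by a constant. The result is a combination of \<open>f x, f (2x), \<dots>, f (2\<^sup>s x)\<close> with integer
  coefficients, as is needed to control sines.
\<close>

fun dyadic_diff :: "nat \<Rightarrow> (real \<Rightarrow> real) \<Rightarrow> real \<Rightarrow> real" where
  "dyadic_diff 0 f x = f x"
| "dyadic_diff (Suc s) f x = 4 ^ s * dyadic_diff s f (2 * x) - 2 * dyadic_diff s f x"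

lemma abs_sin_diff_le: "\<bar>sin (x - y)\<bar> \<le> \<bar>sin x\<bar> + \<bar>sin (y::real)\<bar>"
proof -
  have "\<bar>sin (x - y)\<bar> \<le> \<bar>sin x * cos y\<bar> + \<bar>cos x * sin y\<bar>"
    by (simp add: sin_diff)
  also have "\<dots> \<le> \<bar>sin x\<bar> * 1 + 1 * \<bar>sin y\<bar>"
    unfolding abs_mult by (intro add_mono mult_mono) auto
  finally show ?thesis by simp
qed

lemma abs_sin_of_nat_mult_le: "\<bar>sin (of_nat n * x)\<bar> \<le> of_nat n * \<bar>sin (x::real)\<bar>"
proof (induction n)
  case (Suc n)
  have "\<bar>sin (of_nat (Suc n) * x)\<bar> = \<bar>sin (of_nat n * x - (- x))\<bar>"
    by (simp add: algebra_simps)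
  also have "\<dots> \<le> \<bar>sin (of_nat n * x)\<bar> + \<bar>sin (- x)\<bar>"
    by (rule abs_sin_diff_le)
  finally show ?case using Suc by (simp add: algebra_simps)
qed simp

text \<open>
  Since \<open>|sin|\<close> is subadditive, an integer combination of angles whose sines are small has a small
  sine. The product bounds the sum of the absolute values of the coefficients.
\<close>

lemma abs_sin_dyadic_diff_le:
  assumes "\<And>a. a \<le> s \<Longrightarrow> \<bar>sin (r * f (2 ^ a * x))\<bar> \<le> \<eta>"
  shows "\<bar>sin (r * dyadic_diff s f x)\<bar> \<le> (\<Prod>j<s. 4 ^ j + 2) * \<eta>"
  using assms
proof (induction s arbitrary: x)
  case 0
  then show ?case using 0[of 0] by simp
next
  case (Suc s)
  let ?D = "dyadic_diff s f" and ?K = "(\<Prod>j<s. 4 ^ j + 2) :: real"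
  have 1: "\<bar>sin (r * ?D (2 * x))\<bar> \<le> ?K * \<eta>"
  proof (rule Suc.IH)
    fix a assume "a \<le> s"
    then show "\<bar>sin (r * f (2 ^ a * (2 * x)))\<bar> \<le> \<eta>"
      using Suc.prems[of "Suc a"] by (simp add: mult_ac)
  qed
  have 2: "\<bar>sin (r * ?D x)\<bar> \<le> ?K * \<eta>"
    by (rule Suc.IH) (use Suc.prems in auto)
  have "r * dyadic_diff (Suc s) f x = of_nat (4 ^ s) * (r * ?D (2 * x)) - of_nat 2 * (r * ?D x)"
    by (simp add: algebra_simps)
  then have "\<bar>sin (r * dyadic_diff (Suc s) f x)\<bar>
      \<le> \<bar>sin (of_nat (4 ^ s) * (r * ?D (2 * x)))\<bar> + \<bar>sin (of_nat 2 * (r * ?D x))\<bar>"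
    using abs_sin_diff_le by simp
  also have "\<dots> \<le> of_nat (4 ^ s) * \<bar>sin (r * ?D (2 * x))\<bar> + of_nat 2 * \<bar>sin (r * ?D x)\<bar>"
    by (intro add_mono abs_sin_of_nat_mult_le)
  also have "\<dots> \<le> of_nat (4 ^ s) * (?K * \<eta>) + of_nat 2 * (?K * \<eta>)"
    by (intro add_mono mult_left_mono 1 2) auto
  finally show ?case by (simp add: algebra_simps)
qed

text \<open>
  The eigenvalue of the operator \<open>dyadic_diff s\<close> on the function \<open>x\<^bsup>1-2i\<^esup>\<close>.
\<close>

definition dyadic_factor :: "nat \<Rightarrow> nat \<Rightarrow> real" where
  "dyadic_factor s i = (\<Prod>j<s. 2 * (4 ^ j / 4 ^ i - 1))"

lemma dyadic_factor_eq_0: "i < s \<Longrightarrow> dyadic_factor s i = 0"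
  unfolding dyadic_factor_def by (rule prod_zero) (auto intro!: bexI[of _ i])

lemma dyadic_factor_diag: "dyadic_factor s s \<noteq> 0"
proof -
  have "2 * (4 ^ j / 4 ^ s - 1) \<noteq> (0::real)" if "j < s" for j
  proof -
    have "4 ^ j / 4 ^ s < (1::real)"
      using power_strict_increasing[OF that, of "4::real"] by simp
    moreover have "2 * (q - 1) \<noteq> 0" if "q < 1" for q :: real using that by simp
    ultimately show ?thesis by blast
  qed
  then show ?thesis unfolding dyadic_factor_def by (subst prod_zero_iff) blast+
qed

lemma dyadic_diff_sums:
  assumes "\<And>x. x > 1 \<Longrightarrow> (\<lambda>i. b i * (1 / x\<^sup>2) ^ i) sums (f x / x)" and "x > 1"
  shows "(\<lambda>i. b i * dyadic_factor s i * (1 / x\<^sup>2) ^ i) sums (dyadic_diff s f x / x)"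
  using assms(2)
proof (induction s arbitrary: x)
  case 0
  then show ?case using assms(1)[of x] by (simp add: dyadic_factor_def)
next
  case (Suc s)
  have "(\<lambda>i. b i * dyadic_factor s i * (1 / (2 * x)\<^sup>2) ^ i) sums (dyadic_diff s f (2 * x) / (2 * x))"
    by (rule Suc.IH) (use Suc.prems in auto)
  from sums_diff[OF sums_mult[OF this, of "2 * 4 ^ s"] sums_mult[OF Suc.IH[OF Suc.prems], of 2]]
  have "(\<lambda>i. 2 * 4 ^ s * (b i * dyadic_factor s i * (1 / (2 * x)\<^sup>2) ^ i) - 2 * (b i * dyadic_factor s i * (1 / x\<^sup>2) ^ i))
     sums (2 * 4 ^ s * (dyadic_diff s f (2 * x) / (2 * x)) - 2 * (dyadic_diff s f x / x))" .
  also have "2 * 4 ^ s * (dyadic_diff s f (2 * x) / (2 * x)) - 2 * (dyadic_diff s f x / x) = dyadic_diff (Suc s) f x / x"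
    by (simp add: diff_divide_distrib)
  also have "(\<lambda>i. 2 * 4 ^ s * (b i * dyadic_factor s i * (1 / (2 * x)\<^sup>2) ^ i) - 2 * (b i * dyadic_factor s i * (1 / x\<^sup>2) ^ i))
     = (\<lambda>i. b i * dyadic_factor (Suc s) i * (1 / x\<^sup>2) ^ i)"
  proof
    fix i
    have "(1 / (2 * x)\<^sup>2) ^ i = (1 / x\<^sup>2) ^ i / 4 ^ i"
      by (simp add: power_mult_distrib power_divide)
    then show "2 * 4 ^ s * (b i * dyadic_factor s i * (1 / (2 * x)\<^sup>2) ^ i) - 2 * (b i * dyadic_factor s i * (1 / x\<^sup>2) ^ i)
      = b i * dyadic_factor (Suc s) i * (1 / x\<^sup>2) ^ i"
      by (simp add: dyadic_factor_def algebra_simps)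
  qed
  finally show ?case .
qed

text \<open>
  By \<open>dyadic_factor_eq_0\<close> the expansion of \<open>dyadic_diff s f\<close> starts with the \<open>s\<close>-th term. The rest
  is a power series in \<open>1 / x\<^sup>2\<close>, and such a series is continuous at \<open>0\<close>.
\<close>

lemma dyadic_diff_limit:
  assumes "\<And>x. x > 1 \<Longrightarrow> (\<lambda>i. b i * (1 / x\<^sup>2) ^ i) sums (f x / x)" and "s > 0"
  shows "((\<lambda>x. dyadic_diff s f x * x ^ (2 * s - 1)) \<longlongrightarrow> b s * dyadic_factor s s) at_top"
proof -
  define c where "c i = b (i + s) * dyadic_factor s (i + s)" for i
  have sums: "(\<lambda>i. c i * (1 / x\<^sup>2) ^ i) sums (dyadic_diff s f x * x ^ (2 * s - 1))" if x: "x > 1" for x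
  proof -
    have "(\<lambda>i. b (i + s) * dyadic_factor s (i + s) * (1 / x\<^sup>2) ^ (i + s)) sums (dyadic_diff s f x / x)"
      using dyadic_diff_sums[OF assms(1) x, of s]
      by (subst sums_iff_shift) (auto simp: dyadic_factor_eq_0)
    from sums_mult[OF this, of "(x\<^sup>2) ^ s"]
    have "(\<lambda>i. (x\<^sup>2) ^ s * (b (i + s) * dyadic_factor s (i + s) * (1 / x\<^sup>2) ^ (i + s))) sums ((x\<^sup>2) ^ s * (dyadic_diff s f x / x))" .
    also have "(\<lambda>i. (x\<^sup>2) ^ s * (b (i + s) * dyadic_factor s (i + s) * (1 / x\<^sup>2) ^ (i + s))) = (\<lambda>i. c i * (1 / x\<^sup>2) ^ i)"
      using x by (simp add: c_def power_add power_divide mult_ac)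
    also have "(x\<^sup>2) ^ s * (dyadic_diff s f x / x) = dyadic_diff s f x * x ^ (2 * s - 1)"
    proof -
      have "(x\<^sup>2) ^ s = x * x ^ (2 * s - 1)"
        using \<open>s > 0\<close> by (simp flip: power_mult power_Suc)
      then show ?thesis using x by simp
    qed
    finally show ?thesis .
  qed
  have summ: "summable (\<lambda>i. c i * u ^ i)" if u: "norm u < 1" for u :: real
  proof -
    \<comment> \<open>The expansion is available only at positive points \<open>1 / x\<^sup>2\<close>; take one of these beyond \<open>norm u\<close>.\<close>
  define v where "v = (norm u + 1) / 2"
    have v: "norm u < v" "0 < v" "v < 1" using u by (auto simp: v_def)
    define x where "x = 1 / sqrt v"
    have "x > 1" "1 / x\<^sup>2 = v" using v by (auto simp: x_def power_divide)
    with sums[of x] have "summable (\<lambda>i. c i * v ^ i)" by (auto simp: sums_iff)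
    then show ?thesis by (rule powser_inside) (use v in auto)
  qed
  have "((\<lambda>u. \<Sum>i. c i * u ^ i) \<longlongrightarrow> c 0) (at (0::real))"
    by (rule powser_limit_0[of 1]) (use summ in \<open>auto intro: summable_sums\<close>)
  moreover have "filterlim (\<lambda>x::real. 1 / x\<^sup>2) (at 0) at_top"
    by real_asymp
  ultimately have "((\<lambda>x::real. \<Sum>i. c i * (1 / x\<^sup>2) ^ i) \<longlongrightarrow> c 0) at_top"
    by (rule filterlim_compose)
  then have "((\<lambda>x. dyadic_diff s f x * x ^ (2 * s - 1)) \<longlongrightarrow> c 0) at_top"
  proof (rule Lim_transform_eventually)
    show "\<forall>\<^sub>F x in at_top. (\<Sum>i. c i * (1 / x\<^sup>2) ^ i) = dyadic_diff s f x * x ^ (2 * s - 1)"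
      using eventually_gt_at_top[of 1] by eventually_elim (use sums in \<open>auto simp: sums_iff\<close>)
  qed
  then show ?thesis by (simp add: c_def)
qed

lemma gbinomial_half_nonzero: "(1/2 :: real) gchoose s \<noteq> 0"
proof -
  have "1/2 - real i \<noteq> 0" for i
  proof
    assume "1/2 - real i = 0"
    then have "real 1 = real (2 * i)" by simp
    then show False by (simp only: of_nat_eq_iff) presburger
  qed
  then show ?thesis by (simp add: gbinomial_prod_rev)
qed

lemma sqrt_square_plus_one_sums:
  assumes "x > 1"
  shows "(\<lambda>i. ((1/2) gchoose i) * (1 / x\<^sup>2) ^ i) sums (sqrt (x\<^sup>2 + 1) / x)"
proof -
  have "\<bar>1 / x\<^sup>2\<bar> < 1" using assms by (simp add: one_less_power)
  from gen_binomial_real[OF this, of "1/2"]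
  have "(\<lambda>i. ((1/2) gchoose i) * (1 / x\<^sup>2) ^ i) sums sqrt (1 + 1 / x\<^sup>2)"
    by (simp add: powr_half_sqrt add_nonneg_nonneg)
  also have "1 + 1 / x\<^sup>2 = (x\<^sup>2 + 1) / x\<^sup>2" using assms by (simp add: field_simps)
  also have "sqrt \<dots> = sqrt (x\<^sup>2 + 1) / x" using assms by (simp add: real_sqrt_divide)
  finally show ?thesis .
qed

text \<open>
  Suppose that the sines were small at \<open>2\<^sup>a m\<close> for all \<open>a \<le> s\<close>. Then so would be the sine of
  \<open>2\<pi>\<rho>\<close> times the combination \<open>dyadic_diff s\<close> at \<open>m\<close>, by \<open>abs_sin_dyadic_diff_le\<close>. But that angle is
  asymptotic to \<open>2\<pi>A\<rho> m\<^bsup>1-2s\<^esup>\<close> with \<open>A \<noteq> 0\<close>, and rounding \<open>(4|A|\<rho>)\<^bsup>1/(2s-1)\<^esup>\<close> up to an integer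
  \<open>m\<close> makes it converge to \<open>\<plusminus>\<pi>/2\<close>.
\<close>

lemma sin_sqrt_square_plus_one_large:
  assumes s: "s > 0"
  shows "\<exists>\<kappa>>0. \<exists>K. \<forall>\<^sub>F \<rho> in at_top. \<exists>m::nat. m \<ge> 1 \<and>
           sqrt ((real m)\<^sup>2 + 1) \<le> K * \<rho> powr (1 / real (2 * s - 1)) \<and>
           \<kappa> \<le> \<bar>sin (2 * pi * \<rho> * sqrt ((real m)\<^sup>2 + 1))\<bar>"
proof -
  define f where "f x = sqrt (x\<^sup>2 + 1)" for x :: real
  define p where "p = 2 * s - 1"
  have p: "p > 0" using s by (simp add: p_def)
  define A where "A = ((1/2) gchoose s) * dyadic_factor s s"
  have A: "A \<noteq> 0" using gbinomial_half_nonzero dyadic_factor_diag by (simp add: A_def)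
  have lim: "((\<lambda>x. dyadic_diff s f x * x ^ p) \<longlongrightarrow> A) at_top"
    unfolding A_def p_def f_def by (rule dyadic_diff_limit[OF sqrt_square_plus_one_sums s])
  \<comment> \<open>The factor \<open>4 |A|\<close> makes the limit of the angle exactly \<open>sgn A * (pi / 2)\<close>.\<close>
  define X where "X \<rho> = (4 * \<bar>A\<bar> * \<rho>) powr (1 / real p)" for \<rho>
  define m where "m \<rho> = nat \<lceil>X \<rho>\<rceil>" for \<rho>
  have X: "filterlim X at_top at_top"
    unfolding X_def using A p by real_asymp
  have m_lo: "X \<rho> \<le> real (m \<rho>)" for \<rho>
    unfolding m_def by linarith
  have m_hi: "real (m \<rho>) \<le> X \<rho> + 1" for \<rho>
    unfolding m_def X_def by (simp add: nat_ceiling_le_eq)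
  have m: "filterlim (\<lambda>\<rho>. real (m \<rho>)) at_top at_top"
    by (rule filterlim_at_top_mono[OF X]) (simp add: m_lo)
  have ratio: "((\<lambda>\<rho>. X \<rho> / real (m \<rho>)) \<longlongrightarrow> 1) at_top"
  proof (rule tendsto_sandwich)
    show "((\<lambda>\<rho>. X \<rho> / (X \<rho> + 1)) \<longlongrightarrow> 1) at_top"
      by (rule filterlim_compose[OF _ X]) real_asymp
    show "\<forall>\<^sub>F \<rho> in at_top. X \<rho> / (X \<rho> + 1) \<le> X \<rho> / real (m \<rho>)"
      using X[unfolded filterlim_at_top, rule_format, of 1]
    proof eventually_elim
      case (elim \<rho>)
      then show ?case using m_lo[of \<rho>] m_hi[of \<rho>] by (intro divide_left_mono mult_pos_pos) auto
    qed
    show "\<forall>\<^sub>F \<rho> in at_top. X \<rho> / real (m \<rho>) \<le> 1"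
      using X[unfolded filterlim_at_top, rule_format, of 1]
    proof eventually_elim
      case (elim \<rho>)
      then show ?case using m_lo[of \<rho>] by simp
    qed
  qed simp
  have "((\<lambda>\<rho>. 2 * pi * (dyadic_diff s f (real (m \<rho>)) * real (m \<rho>) ^ p) * ((X \<rho> / real (m \<rho>)) ^ p / (4 * \<bar>A\<bar>)))
      \<longlongrightarrow> 2 * pi * A * (1 ^ p / (4 * \<bar>A\<bar>))) at_top"
    using A by (intro tendsto_intros filterlim_compose[OF lim m] ratio) auto
  also have "2 * pi * A * (1 ^ p / (4 * \<bar>A\<bar>)) = sgn A * (pi / 2)"
    using A by (simp add: sgn_real_def)
  finally have "((\<lambda>\<rho>. 2 * pi * \<rho> * dyadic_diff s f (real (m \<rho>))) \<longlongrightarrow> sgn A * (pi / 2)) at_top"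
  proof (rule Lim_transform_eventually)
    show "\<forall>\<^sub>F \<rho> in at_top. 2 * pi * (dyadic_diff s f (real (m \<rho>)) * real (m \<rho>) ^ p) * ((X \<rho> / real (m \<rho>)) ^ p / (4 * \<bar>A\<bar>))
        = 2 * pi * \<rho> * dyadic_diff s f (real (m \<rho>))"
      using X[unfolded filterlim_at_top, rule_format, of 1] eventually_gt_at_top[of 0]
    proof eventually_elim
      case (elim \<rho>)
      have "X \<rho> ^ p = 4 * \<bar>A\<bar> * \<rho>"
        using elim A p by (simp add: X_def powr_realpow[symmetric] powr_powr)
      moreover have "real (m \<rho>) > 0" using elim m_lo[of \<rho>] by linarith
      ultimately show ?case using A by (simp add: power_divide)
    qed
  qed
  then have "((\<lambda>\<rho>. \<bar>sin (2 * pi * \<rho> * dyadic_diff s f (real (m \<rho>)))\<bar>) \<longlongrightarrow> \<bar>sin (sgn A * (pi / 2))\<bar>) at_top"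
    by (intro tendsto_rabs tendsto_sin)
  moreover have "\<bar>sin (sgn A * (pi / 2))\<bar> = 1"
    using A by (auto simp: sgn_real_def)
  ultimately have big: "\<forall>\<^sub>F \<rho> in at_top. 1/2 < \<bar>sin (2 * pi * \<rho> * dyadic_diff s f (real (m \<rho>)))\<bar>"
    by (intro order_tendstoD) auto
  define P where "P = (\<Prod>j<s. 4 ^ j + 2 :: real)"
  have P: "P > 0" unfolding P_def by (intro prod_pos) (simp add: add_pos_pos)
  define \<kappa> where "\<kappa> = 1 / (2 * P)"
  \<comment> \<open>From \<open>m \<le> 2 X\<close> and \<open>sqrt (M\<^sup>2 + 1) \<le> 2 M\<close> for \<open>M = 2 ^ a * m\<close> with \<open>a \<le> s\<close>.\<close>
  define K where "K = 2 ^ (s + 2) * (4 * \<bar>A\<bar>) powr (1 / real p)"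
  have "\<forall>\<^sub>F \<rho> in at_top. \<exists>m::nat. m \<ge> 1 \<and>
           sqrt ((real m)\<^sup>2 + 1) \<le> K * \<rho> powr (1 / real (2 * s - 1)) \<and>
           \<kappa> \<le> \<bar>sin (2 * pi * \<rho> * sqrt ((real m)\<^sup>2 + 1))\<bar>"
    using big X[unfolded filterlim_at_top, rule_format, of 1] eventually_gt_at_top[of 0]
  proof eventually_elim
    case (elim \<rho>)
    have "\<exists>a\<le>s. \<kappa> < \<bar>sin (2 * pi * \<rho> * f (2 ^ a * real (m \<rho>)))\<bar>"
    proof (rule ccontr)
      assume "\<not> ?thesis"
      then have "\<bar>sin (2 * pi * \<rho> * dyadic_diff s f (real (m \<rho>)))\<bar> \<le> P * \<kappa>"
        unfolding P_def by (intro abs_sin_dyadic_diff_le) (auto simp: not_less)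
      also have "P * \<kappa> = 1/2" using P by (simp add: \<kappa>_def)
      finally show False using elim by simp
    qed
    then obtain a where a: "a \<le> s" "\<kappa> < \<bar>sin (2 * pi * \<rho> * f (2 ^ a * real (m \<rho>)))\<bar>" by blast
    have m1: "1 \<le> real (m \<rho>)" using elim m_lo[of \<rho>] by linarith
    let ?M = "2 ^ a * m \<rho>"
    have M1: "1 \<le> ?M" using m1 by (simp add: Suc_le_eq)
    have "sqrt ((real ?M)\<^sup>2 + 1) \<le> sqrt ((2 * real ?M)\<^sup>2)"
    proof (rule real_sqrt_le_mono)
      have "1 \<le> (real ?M)\<^sup>2" using M1 by (intro one_le_power) linarith
      then show "(real ?M)\<^sup>2 + 1 \<le> (2 * real ?M)\<^sup>2" unfolding power_mult_distrib by simp
    qed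
    also have "\<dots> = 2 * 2 ^ a * real (m \<rho>)" by (subst real_sqrt_abs) simp
    also have "\<dots> \<le> 2 * 2 ^ s * (2 * X \<rho>)"
      using a(1) m_hi[of \<rho>] elim by (intro mult_mono power_increasing) auto
    also have "\<dots> = K * \<rho> powr (1 / real p)"
      using elim by (simp add: K_def X_def powr_mult)
    finally show ?case
      using a(2) M1 by (intro exI[of _ ?M]) (simp add: p_def f_def)
  qed
  moreover have "\<kappa> > 0" using P by (simp add: \<kappa>_def)
  ultimately show ?thesis by blast
qed

section \<open>Unfolding over the torus\<close>

definition unit_cube :: "(real ^ 'k::finite) set" where
  "unit_cube = {x. \<forall>i. 0 \<le> x $ i \<and> x $ i < 1}"

lemma unit_cube_measurable [measurable]: "unit_cube \<in> sets borel"
proof -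
  have [measurable]: "(\<lambda>x::real^'k. x $ i) \<in> borel_measurable borel" for i
    by (intro borel_measurable_continuous_onI continuous_intros)
  have "{x \<in> space borel. \<forall>i\<in>UNIV. 0 \<le> x $ i \<and> x $ i < 1} \<in> sets (borel :: (real^'k) measure)"
    by measurable
  then show ?thesis by (simp add: unit_cube_def)
qed

lemma emeasure_unit_cube: "emeasure lborel (unit_cube :: (real ^ 'k::finite) set) = 1"
proof (rule antisym)
  let ?one = "(\<chi> i. 1) :: real ^ 'k"
  have prod: "(\<Prod>b\<in>Basis. (?one - 0) \<bullet> b) = 1"
    by (rule prod.neutral) (auto simp: Basis_vec_def inner_axis)
  have le: "0 \<bullet> b \<le> ?one \<bullet> b" if "b \<in> Basis" for b
    using that by (auto simp: Basis_vec_def inner_axis)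
  have "emeasure lborel (unit_cube :: (real^'k) set) \<le> emeasure lborel (cbox 0 ?one)"
    by (rule emeasure_mono) (simp_all add: unit_cube_def mem_box_cart subset_iff less_imp_le)
  also have "\<dots> = 1" using emeasure_lborel_cbox[OF le] prod by simp
  finally show "emeasure lborel (unit_cube :: (real^'k) set) \<le> 1" .
  have "1 = emeasure lborel (box 0 ?one)" using emeasure_lborel_box[OF le] prod by simp
  also have "\<dots> \<le> emeasure lborel (unit_cube :: (real^'k) set)"
    by (rule emeasure_mono) (simp_all add: unit_cube_def mem_box_cart subset_iff less_imp_le)
  finally show "1 \<le> emeasure lborel (unit_cube :: (real^'k) set)" .
qed

lemma norm_unit_cube_le:
  fixes x :: "real ^ 'k::finite"
  assumes "x \<in> unit_cube" shows "norm x \<le> CARD('k)"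
proof -
  have "norm x \<le> (\<Sum>i\<in>UNIV. \<bar>x $ i\<bar>)" by (rule norm_le_l1_cart)
  also have "\<dots> \<le> (\<Sum>i\<in>(UNIV::'k set). 1)"
    using assms by (intro sum_mono) (auto simp: unit_cube_def intro: less_imp_le)
  finally show ?thesis by simp
qed

lemma ex1_int_lattice_unit_cube:
  fixes y :: "real ^ 'k::finite"
  shows "\<exists>!\<gamma>. \<gamma> \<in> int_lattice \<and> \<gamma> - y \<in> unit_cube"
proof (rule ex1I)
  show "(\<chi> i. of_int \<lceil>y $ i\<rceil>) \<in> int_lattice \<and> (\<chi> i. of_int \<lceil>y $ i\<rceil>) - y \<in> unit_cube"
    by (auto simp: int_lattice_def unit_cube_def) linarith
  fix \<gamma> assume \<gamma>: "\<gamma> \<in> int_lattice \<and> \<gamma> - y \<in> unit_cube"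
  show "\<gamma> = (\<chi> i. of_int \<lceil>y $ i\<rceil>)"
  proof (subst vec_eq_iff, rule allI)
    fix i
    obtain m where m: "\<gamma> $ i = of_int m"
      using \<gamma> unfolding int_lattice_def by (auto elim: Ints_cases)
    have "0 \<le> \<gamma> $ i - y $ i" "\<gamma> $ i - y $ i < 1" using \<gamma> by (auto simp: unit_cube_def)
    then have "m = \<lceil>y $ i\<rceil>" unfolding m by linarith
    then show "\<gamma> $ i = (\<chi> i. of_int \<lceil>y $ i\<rceil>) $ i" by (simp add: m)
  qed
qed

text \<open>
  A finite set of lattice vectors that contains every \<open>\<gamma>\<close> with \<open>norm (\<gamma> - x) < r\<close> for some \<open>x\<close> in the
  unit cube. A set that does not depend on \<open>x\<close> lets sums be interchanged with integrals.
\<close>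

definition lattice_points :: "real \<Rightarrow> (real ^ 'k::finite) set" where
  "lattice_points r = {\<gamma> \<in> int_lattice. norm \<gamma> < r + CARD('k)}"

lemma finite_lattice_points [simp]: "finite (lattice_points r)"
  using finite_int_lattice_ball[of 0] by (simp add: lattice_points_def)

text \<open>
  The usual unfolding: the reflected cubes \<open>\<gamma> - Q\<close> tile the space, so the integral over the cube \<open>Q\<close> of a
  periodization is an integral over the whole space.
\<close>

lemma nn_integral_unfold:
  fixes F \<phi> :: "real ^ 'k::finite \<Rightarrow> ennreal"
  assumes [measurable]: "F \<in> borel_measurable borel" "\<phi> \<in> borel_measurable borel"
    and periodic: "\<And>\<gamma> y. \<gamma> \<in> int_lattice \<Longrightarrow> \<phi> (\<gamma> - y) = \<phi> y"
    and support: "\<And>y. norm y \<ge> r \<Longrightarrow> F y = 0"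
  shows "(\<integral>\<^sup>+x. indicator unit_cube x * (\<phi> x * (\<Sum>\<gamma>\<in>lattice_points r. F (\<gamma> - x))) \<partial>lborel)
       = (\<integral>\<^sup>+y. F y * \<phi> y \<partial>lborel)"
proof -
  let ?h = "\<lambda>x. indicator unit_cube x * \<phi> x"
  have "(\<integral>\<^sup>+x. indicator unit_cube x * (\<phi> x * (\<Sum>\<gamma>\<in>lattice_points r. F (\<gamma> - x))) \<partial>lborel)
      = (\<integral>\<^sup>+x. (\<Sum>\<gamma>\<in>lattice_points r. ?h x * F (\<gamma> - x)) \<partial>lborel)"
    by (simp add: sum_distrib_left mult.assoc)
  also have "\<dots> = (\<Sum>\<gamma>\<in>lattice_points r. \<integral>\<^sup>+x. ?h x * F (\<gamma> - x) \<partial>lborel)"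
    by (rule nn_integral_sum) measurable
  also have "\<dots> = (\<Sum>\<gamma>\<in>lattice_points r. \<integral>\<^sup>+y. ?h (\<gamma> - y) * F y \<partial>lborel)"
  proof (rule sum.cong)
    fix \<gamma> :: "real^'k"
    have "(\<integral>\<^sup>+y. ?h (\<gamma> - y) * F (\<gamma> - (\<gamma> - y)) \<partial>lborel) = (\<integral>\<^sup>+x. ?h x * F (\<gamma> - x) \<partial>lborel)"
      by (rule nn_integral_lborel_reflect[where g = "\<lambda>x. ?h x * F (\<gamma> - x)"]) measurable
    then show "(\<integral>\<^sup>+x. ?h x * F (\<gamma> - x) \<partial>lborel) = (\<integral>\<^sup>+y. ?h (\<gamma> - y) * F y \<partial>lborel)" by simp
  qed simp
  also have "\<dots> = (\<integral>\<^sup>+y. (\<Sum>\<gamma>\<in>lattice_points r. ?h (\<gamma> - y) * F y) \<partial>lborel)"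
    by (rule nn_integral_sum[symmetric]) measurable
  also have "\<dots> = (\<integral>\<^sup>+y. F y * \<phi> y \<partial>lborel)"
  proof (rule nn_integral_cong)
    fix y :: "real^'k"
    show "(\<Sum>\<gamma>\<in>lattice_points r. ?h (\<gamma> - y) * F y) = F y * \<phi> y"
    proof (cases "norm y < r")
      case False
      then show ?thesis using support[of y] by simp
    next
      case True
      obtain \<delta> where \<delta>: "\<delta> \<in> int_lattice" "\<delta> - y \<in> unit_cube"
        and unique: "\<And>\<gamma>. \<gamma> \<in> int_lattice \<Longrightarrow> \<gamma> - y \<in> unit_cube \<Longrightarrow> \<gamma> = \<delta>"
        using ex1_int_lattice_unit_cube[of y] by blast
      have "norm \<delta> < r + CARD('k)"
        using norm_triangle_ineq[of "\<delta> - y" y] norm_unit_cube_le[OF \<delta>(2)] True by simp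
      then have mem: "\<delta> \<in> lattice_points r" using \<delta> by (simp add: lattice_points_def)
      have "(\<Sum>\<gamma>\<in>lattice_points r. ?h (\<gamma> - y) * F y) = (\<Sum>\<gamma>\<in>{\<delta>}. ?h (\<gamma> - y) * F y)"
        using mem unique
        by (intro sum.mono_neutral_right[OF finite_lattice_points]) (auto simp: lattice_points_def indicator_def)
      also have "\<dots> = F y * \<phi> y" using \<delta> by (simp add: periodic mult.commute)
      finally show ?thesis .
    qed
  qed
  finally show ?thesis .
qed

lemma int_lattice_inner:
  assumes "\<gamma> \<in> int_lattice" "g \<in> int_lattice" shows "\<gamma> \<bullet> g \<in> \<int>"
  using assms by (auto simp: int_lattice_def inner_vec_def intro!: Ints_sum)

lemma sqrt_power_eq_powr: "x > 0 \<Longrightarrow> sqrt x ^ m = x powr (real m / 2)"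
  by (simp add: powr_half_sqrt[symmetric] powr_powr powr_realpow[symmetric])

lemma S_vol_eq_sum:
  fixes x :: "real ^ 'k::finite"
  assumes "\<rho> > 0" "x \<in> unit_cube"
  shows "S_vol d \<rho> x = (\<Sum>\<gamma>\<in>lattice_points \<rho>. ball_volume_sq (d - CARD('k)) (\<rho>\<^sup>2 - (norm (\<gamma> - x))\<^sup>2))"
proof -
  let ?l = "d - CARD('k)"
  have pos: "0 < \<rho>\<^sup>2 - (norm (\<gamma> - x))\<^sup>2 \<longleftrightarrow> norm (\<gamma> - x) < \<rho>" for \<gamma>
    using assms(1) by (auto intro!: power_strict_mono dest: power2_less_imp_less)
  have "S_vol d \<rho> x = (\<Sum>\<gamma> | \<gamma> \<in> int_lattice \<and> norm (\<gamma> - x) < \<rho>. ball_volume_sq ?l (\<rho>\<^sup>2 - (norm (\<gamma> - x))\<^sup>2))"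
    unfolding S_vol_def Let_def sum_distrib_left
  proof (rule sum.cong)
    fix \<gamma> assume "\<gamma> \<in> {\<gamma> \<in> int_lattice. norm (\<gamma> - x) < \<rho>}"
    then have "0 < \<rho>\<^sup>2 - (norm (\<gamma> - x))\<^sup>2" by (subst pos) simp
    then show "unit_ball_vol (real ?l) * (\<rho>\<^sup>2 - (norm (\<gamma> - x))\<^sup>2) powr (real ?l / 2)
        = ball_volume_sq ?l (\<rho>\<^sup>2 - (norm (\<gamma> - x))\<^sup>2)"
      by (simp add: ball_volume_sq_def sqrt_power_eq_powr)
  qed simp
  also have "\<dots> = (\<Sum>\<gamma>\<in>lattice_points \<rho>. ball_volume_sq ?l (\<rho>\<^sup>2 - (norm (\<gamma> - x))\<^sup>2))"
  proof (rule sum.mono_neutral_left)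
    show "{\<gamma> \<in> int_lattice. norm (\<gamma> - x) < \<rho>} \<subseteq> lattice_points \<rho>"
    proof
      fix \<gamma> assume "\<gamma> \<in> {\<gamma> \<in> int_lattice. norm (\<gamma> - x) < \<rho>}"
      then show "\<gamma> \<in> lattice_points \<rho>"
        using norm_triangle_ineq[of "\<gamma> - x" x] norm_unit_cube_le[OF assms(2)]
        by (simp add: lattice_points_def)
    qed
    show "\<forall>\<gamma>\<in>lattice_points \<rho> - {\<gamma> \<in> int_lattice. norm (\<gamma> - x) < \<rho>}. ball_volume_sq ?l (\<rho>\<^sup>2 - (norm (\<gamma> - x))\<^sup>2) = 0"
      using pos by (auto simp: lattice_points_def ball_volume_sq_def)
  qed simp
  finally show ?thesis .
qed

lemma S_vol_nonneg: "S_vol d \<rho> (x :: real ^ 'k::finite) \<ge> 0"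
  by (simp add: S_vol_def Let_def sum_nonneg)

text \<open>
  For \<open>\<sigma> = \<plusminus>1\<close> this is the nonnegative weight that detects the Fourier coefficient at \<open>g\<close>.
\<close>

definition wave :: "real \<Rightarrow> real ^ 'k::finite \<Rightarrow> real ^ 'k \<Rightarrow> real" where
  "wave \<sigma> g x = 1 + \<sigma> * cos (2 * pi * (x \<bullet> g))"

lemma wave_nonneg: "\<bar>\<sigma>\<bar> = 1 \<Longrightarrow> 0 \<le> wave \<sigma> g x"
proof -
  assume "\<bar>\<sigma>\<bar> = 1"
  then have "\<bar>\<sigma> * cos (2 * pi * (x \<bullet> g))\<bar> \<le> 1" unfolding abs_mult by simp
  then show ?thesis unfolding wave_def by linarith
qed

lemma wave_measurable [measurable]: "wave \<sigma> g \<in> borel_measurable borel"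
  unfolding wave_def[abs_def] by measurable

lemma wave_periodic:
  assumes "g \<in> int_lattice" "\<gamma> \<in> int_lattice"
  shows "wave \<sigma> g (\<gamma> - y) = wave \<sigma> g y"
proof -
  obtain m where m: "\<gamma> \<bullet> g = of_int m"
    using int_lattice_inner[OF assms(2,1)] by (auto elim: Ints_cases)
  have "cos (2 * pi * ((\<gamma> - y) \<bullet> g)) = cos (2 * pi * of_int m - 2 * pi * (y \<bullet> g))"
    by (simp add: inner_diff_left m algebra_simps)
  also have "\<dots> = cos (2 * pi * (y \<bullet> g))"
    by (simp only: cos_diff sin_int_2pin cos_int_2pin)
  finally show ?thesis by (simp add: wave_def)
qed

text \<open>
  Shifting by the vector \<open>a\<close> with \<open>a \<bullet> g = 1/2\<close> changes the sign of the cosine. Integrals of periodic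
  functions over the cube are invariant under \<open>x \<mapsto> a - x\<close>, which is the unfolding lemma for the
  indicator function of a shifted cube; hence the weights for \<open>\<sigma>\<close> and \<open>-\<sigma>\<close> have the same mean,
  and their sum is \<open>2\<close>.
\<close>

lemma nn_integral_wave_unit_cube:
  fixes g :: "real ^ 'k::finite"
  assumes g: "g \<in> int_lattice" "g \<noteq> 0" and \<sigma>: "\<bar>\<sigma>\<bar> = 1"
  shows "(\<integral>\<^sup>+x. indicator unit_cube x * ennreal (wave \<sigma> g x) \<partial>lborel) = 1"
proof -
  define a where "a = (1 / (2 * (norm g)\<^sup>2)) *\<^sub>R g"
  have ag: "a \<bullet> g = 1 / 2" using g by (simp add: a_def power2_norm_eq_inner)
  have shift: "wave \<sigma> g (a - y) = wave (- \<sigma>) g y" for y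
    by (simp add: wave_def inner_diff_left ag right_diff_distrib cos_diff)
  let ?F = "\<lambda>y. indicator unit_cube (a - y) :: ennreal"
  define r where "r = norm a + CARD('k) + 1"
  have F0: "?F y = 0" if "norm y \<ge> r" for y
  proof (rule ccontr)
    assume "?F y \<noteq> 0"
    then have "norm (a - y) \<le> CARD('k)" by (auto simp: indicator_def norm_unit_cube_le split: if_splits)
    then show False using that norm_triangle_ineq2[of y a] by (simp add: r_def norm_minus_commute)
  qed
  have one: "(\<Sum>\<gamma>\<in>lattice_points r. ?F (\<gamma> - x)) = 1" if x: "x \<in> unit_cube" for x
  proof -
    obtain \<delta> where \<delta>: "\<delta> \<in> int_lattice" "\<delta> - (- (a + x)) \<in> unit_cube"
      and unique: "\<And>\<gamma>. \<gamma> \<in> int_lattice \<Longrightarrow> \<gamma> - (- (a + x)) \<in> unit_cube \<Longrightarrow> \<gamma> = \<delta>"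
      using ex1_int_lattice_unit_cube[of "- (a + x)"] by blast
    have eq: "a - (- \<delta> - x) = \<delta> - (- (a + x))" by simp
    have "norm (\<delta> - (- (a + x))) \<le> CARD('k)" by (rule norm_unit_cube_le[OF \<delta>(2)])
    moreover have "norm \<delta> \<le> norm (\<delta> - (- (a + x))) + norm (a + x)"
      using norm_triangle_ineq4[of "\<delta> - (- (a + x))" "a + x"] by simp
    moreover have "norm (a + x) \<le> norm a + CARD('k)"
      using norm_triangle_ineq[of a x] norm_unit_cube_le[OF x] by simp
    ultimately have "norm \<delta> < r + CARD('k)" unfolding r_def by linarith
    then have mem: "- \<delta> \<in> lattice_points r"
      using \<delta>(1) by (simp add: lattice_points_def int_lattice_uminus)
    have "(\<Sum>\<gamma>\<in>lattice_points r. ?F (\<gamma> - x)) = (\<Sum>\<gamma>\<in>{- \<delta>}. ?F (\<gamma> - x))"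
    proof (rule sum.mono_neutral_right)
      show "\<forall>\<gamma>\<in>lattice_points r - {- \<delta>}. ?F (\<gamma> - x) = 0"
      proof
        fix \<gamma> assume \<gamma>: "\<gamma> \<in> lattice_points r - {- \<delta>}"
        have "a - (\<gamma> - x) = - \<gamma> - (- (a + x))" by simp
        moreover have "- \<gamma> \<in> int_lattice" using \<gamma> by (auto simp: lattice_points_def int_lattice_uminus)
        moreover have "- \<gamma> \<noteq> \<delta>" using \<gamma> by auto
        ultimately have "a - (\<gamma> - x) \<notin> unit_cube" using unique[of "- \<gamma>"] by metis
        then show "?F (\<gamma> - x) = 0" by simp
      qed
    qed (use mem in auto)
    also have "\<dots> = 1" using \<delta>(2) by (simp add: eq add.commute)
    finally show ?thesis .
  qed
  let ?I = "\<lambda>\<sigma>. \<integral>\<^sup>+x. indicator unit_cube x * ennreal (wave \<sigma> g x) \<partial>lborel"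
  have "?I \<sigma> = (\<integral>\<^sup>+x. indicator unit_cube x * (ennreal (wave \<sigma> g x) * (\<Sum>\<gamma>\<in>lattice_points r. ?F (\<gamma> - x))) \<partial>lborel)"
  proof (rule nn_integral_cong)
    fix x :: "real^'k"
    show "indicator unit_cube x * ennreal (wave \<sigma> g x)
        = indicator unit_cube x * (ennreal (wave \<sigma> g x) * (\<Sum>\<gamma>\<in>lattice_points r. ?F (\<gamma> - x)))"
    proof (cases "x \<in> unit_cube")
      case True
      then show ?thesis by (simp only: one mult_1_right)
    qed simp
  qed
  also have "\<dots> = (\<integral>\<^sup>+y. ?F y * ennreal (wave \<sigma> g y) \<partial>lborel)"
    by (rule nn_integral_unfold) (use F0 wave_periodic[OF g(1)] in auto)
  also have "\<dots> = (\<integral>\<^sup>+y. ?F (a - y) * ennreal (wave \<sigma> g (a - y)) \<partial>lborel)"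
    by (rule nn_integral_lborel_reflect[symmetric]) measurable
  also have "\<dots> = ?I (- \<sigma>)" by (simp add: shift)
  finally have eq: "?I \<sigma> = ?I (- \<sigma>)" .
  have "?I \<sigma> + ?I (- \<sigma>) = (\<integral>\<^sup>+x. 2 * indicator (unit_cube :: (real^'k) set) x \<partial>lborel)"
  proof (subst nn_integral_add[symmetric])
    have "ennreal (wave \<sigma> g x) + ennreal (wave (- \<sigma>) g x) = 2" for x
      using wave_nonneg[OF \<sigma>, of g x] wave_nonneg[of "- \<sigma>" g x] \<sigma>
      by (subst ennreal_plus[symmetric]) (auto simp: wave_def)
    then show "(\<integral>\<^sup>+x. indicator unit_cube x * ennreal (wave \<sigma> g x) + indicator unit_cube x * ennreal (wave (- \<sigma>) g x) \<partial>lborel)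
        = (\<integral>\<^sup>+x. 2 * indicator (unit_cube :: (real^'k) set) x \<partial>lborel)"
      by (simp add: distrib_left[symmetric] mult.commute)
  qed measurable
  also have "\<dots> = 2" by (simp add: nn_integral_cmult emeasure_unit_cube)
  finally have "2 * ?I \<sigma> = 2 * 1" unfolding eq[symmetric] by (simp add: mult_2)
  then show ?thesis by (subst (asm) ennreal_mult_cancel_left) auto
qed


section \<open>Fourier coefficients of the error term\<close>

lemma bessel_integral_0:
  "unit_ball_vol (real n) * bessel_integral n 0 = unit_ball_vol (real (Suc n))"
proof -
  have int: "((\<lambda>t::real. sqrt (1 - t\<^sup>2) ^ n) has_integral bessel_integral n 0) {-1..1}"
    unfolding bessel_integral_def
    by (simp, intro integrable_integral integrable_continuous_interval continuous_intros)
  have nonneg: "0 \<le> sqrt (1 - t\<^sup>2) ^ n" if "t \<in> {-1..1}" for t :: real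
    using that by (simp add: abs_square_le_1 abs_le_iff)
  have "ennreal (bessel_integral n 0) = (\<integral>\<^sup>+t. ennreal (indicator {-1..1} t * sqrt (1 - t\<^sup>2) ^ n) \<partial>lborel)"
    by (rule nn_integral_has_integral_lebesgue[OF nonneg int, symmetric])
  also have "\<dots> = ennreal (Beta (1 / 2) (real n / 2 + 1))" by (rule emeasure_cball_aux_integral)
  finally have "bessel_integral n 0 = Beta (1 / 2) (real n / 2 + 1)"
    using has_integral_nonneg[OF int nonneg] by (simp add: Beta_def)
  then show ?thesis by (simp only: unit_ball_vol_Suc_Beta)
qed

lemma nn_integral_slice_wave:
  assumes n: "n > 0" and \<rho>: "\<rho> > 0" and \<sigma>: "\<bar>\<sigma>\<bar> = 1"
  shows "(\<integral>\<^sup>+t. ennreal (ball_volume_sq n (\<rho>\<^sup>2 - t\<^sup>2)) * ennreal (1 + \<sigma> * cos (w * t)) \<partial>lborel)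
       = ennreal (unit_ball_vol (real (Suc n)) * \<rho> ^ Suc n + \<sigma> * (unit_ball_vol (real n) * \<rho> ^ Suc n * bessel_integral n (\<rho> * w)))"
proof -
  have cos_nonneg: "0 \<le> 1 + \<sigma> * cos x" for x
  proof -
    have "\<bar>\<sigma> * cos x\<bar> \<le> 1" using \<sigma> unfolding abs_mult by simp
    then show ?thesis by linarith
  qed
  let ?s = "\<lambda>t. sqrt (1 - t\<^sup>2) ^ n"
  have int: "((\<lambda>t. ?s t * cos (z * t)) has_integral bessel_integral n z) {-1..1}" for z
    unfolding bessel_integral_def
    by (intro integrable_integral integrable_continuous_interval continuous_intros)
  have "((\<lambda>t. ?s t * cos (0 * t) + \<sigma> * (?s t * cos (\<rho> * w * t))) has_integral bessel_integral n 0 + \<sigma> * bessel_integral n (\<rho> * w)) {-1..1}"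
    by (intro has_integral_add has_integral_mult_right int)
  then have int': "((\<lambda>t. ?s t * (1 + \<sigma> * cos (\<rho> * w * t))) has_integral bessel_integral n 0 + \<sigma> * bessel_integral n (\<rho> * w)) {-1..1}"
    by (simp add: algebra_simps)
  have nonneg: "0 \<le> ?s t" if "t \<in> {-1..1}" for t :: real
    using that by (simp add: abs_square_le_1 abs_le_iff)
  let ?c = "\<rho> ^ Suc n * unit_ball_vol (real n)"
  have "(\<integral>\<^sup>+t. ennreal (ball_volume_sq n (\<rho>\<^sup>2 - t\<^sup>2)) * ennreal (1 + \<sigma> * cos (w * t)) \<partial>lborel)
      = ennreal \<rho> * (\<integral>\<^sup>+t. ennreal (ball_volume_sq n (\<rho>\<^sup>2 - (\<rho> * t)\<^sup>2)) * ennreal (1 + \<sigma> * cos (w * (\<rho> * t))) \<partial>lborel)"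
    using \<rho> by (subst nn_integral_real_affine[where c = \<rho> and t = 0]) auto
  also have "\<dots> = (\<integral>\<^sup>+t. ennreal \<rho> * (ennreal (ball_volume_sq n (\<rho>\<^sup>2 - (\<rho> * t)\<^sup>2)) * ennreal (1 + \<sigma> * cos (w * (\<rho> * t)))) \<partial>lborel)"
    by (rule nn_integral_cmult[symmetric]) measurable
  also have "\<dots> = (\<integral>\<^sup>+t. ennreal ?c * ennreal (indicator {-1..1} t * (?s t * (1 + \<sigma> * cos (\<rho> * w * t)))) \<partial>lborel)"
  proof (rule nn_integral_cong)
    fix t :: real
    have sc: "\<rho>\<^sup>2 - (\<rho> * t)\<^sup>2 = \<rho>\<^sup>2 * (1 - t\<^sup>2)" by (simp add: power_mult_distrib algebra_simps)
    have bv: "ball_volume_sq n (1 - t\<^sup>2) = unit_ball_vol (real n) * (indicator {-1..1} t * ?s t)"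
    proof (cases "\<bar>t\<bar> < 1")
      case True
      then have "t\<^sup>2 < 1" by (simp add: abs_square_less_1)
      moreover have "t \<in> {-1..1}" using True by auto
      ultimately show ?thesis by (simp add: ball_volume_sq_def)
    next
      case False
      then have "1 - t\<^sup>2 \<le> 0" by (simp add: abs_square_less_1 flip: not_less)
      moreover have "t \<in> {-1..1} \<Longrightarrow> t\<^sup>2 = 1" using False by (auto simp: power2_eq_1_iff)
      ultimately show ?thesis using n by (auto simp: indicator_def)
    qed
    show "ennreal \<rho> * (ennreal (ball_volume_sq n (\<rho>\<^sup>2 - (\<rho> * t)\<^sup>2)) * ennreal (1 + \<sigma> * cos (w * (\<rho> * t))))
       = ennreal ?c * ennreal (indicator {-1..1} t * (?s t * (1 + \<sigma> * cos (\<rho> * w * t))))"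
    proof -
      let ?X = "\<rho> ^ n * (unit_ball_vol (real n) * (indicator {-1..1} t * ?s t))" and ?Y = "1 + \<sigma> * cos (w * (\<rho> * t))"
      have X: "0 \<le> ?X" using \<rho> nonneg[of t] by (simp add: indicator_def)
      have Y: "0 \<le> ?Y" by (rule cos_nonneg)
      have c: "0 \<le> ?c" using \<rho> by simp
      have "ennreal \<rho> * (ennreal ?X * ennreal ?Y) = ennreal (\<rho> * (?X * ?Y))"
        using \<rho> X Y by (simp only: ennreal_mult[symmetric] mult_nonneg_nonneg less_imp_le)
      also have "\<rho> * (?X * ?Y) = ?c * (indicator {-1..1} t * (?s t * (1 + \<sigma> * cos (\<rho> * w * t))))"
        by (simp add: mult_ac)
      also have "ennreal \<dots> = ennreal ?c * ennreal (indicator {-1..1} t * (?s t * (1 + \<sigma> * cos (\<rho> * w * t))))"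
        by (rule ennreal_mult'[OF c])
      finally show ?thesis unfolding sc ball_volume_sq_scale[OF \<rho>] bv .
    qed
  qed
  also have "\<dots> = ennreal ?c * (\<integral>\<^sup>+t. ennreal (indicator {-1..1} t * (?s t * (1 + \<sigma> * cos (\<rho> * w * t)))) \<partial>lborel)"
    by (rule nn_integral_cmult) measurable
  also have "(\<integral>\<^sup>+t. ennreal (indicator {-1..1} t * (?s t * (1 + \<sigma> * cos (\<rho> * w * t)))) \<partial>lborel)
      = ennreal (bessel_integral n 0 + \<sigma> * bessel_integral n (\<rho> * w))"
    by (rule nn_integral_has_integral_lebesgue[OF _ int']) (intro mult_nonneg_nonneg nonneg cos_nonneg)
  also have "ennreal ?c * \<dots> = ennreal (?c * (bessel_integral n 0 + \<sigma> * bessel_integral n (\<rho> * w)))"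
    using \<rho> by (intro ennreal_mult[symmetric] has_integral_nonneg[OF int']) (auto intro!: mult_nonneg_nonneg nonneg cos_nonneg)
  also have "?c * (bessel_integral n 0 + \<sigma> * bessel_integral n (\<rho> * w))
     = unit_ball_vol (real (Suc n)) * \<rho> ^ Suc n + \<sigma> * (unit_ball_vol (real n) * \<rho> ^ Suc n * bessel_integral n (\<rho> * w))"
    unfolding bessel_integral_0[symmetric] by (simp add: algebra_simps)
  finally show ?thesis .
qed

text \<open>
  Unfolding replaces the sum over the lattice by an integral over the whole space, and there
  the weight depends only on the component of \<open>y\<close> along \<open>g\<close>, so the ball can be sliced orthogonally to
  \<open>g\<close>.
\<close>

lemma nn_integral_wave_S_vol:
  fixes g :: "real ^ 'k::finite"
  assumes d: "CARD('k) \<le> d" "2 \<le> d" and \<rho>: "\<rho> > 0" and g: "g \<in> int_lattice" "g \<noteq> 0" and \<sigma>: "\<bar>\<sigma>\<bar> = 1"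
  shows "(\<integral>\<^sup>+x. indicator unit_cube x * (ennreal (wave \<sigma> g x) * ennreal (S_vol d \<rho> x)) \<partial>lborel)
       = ennreal (unit_ball_vol (real d) * \<rho> ^ d
           + \<sigma> * (unit_ball_vol (real (d - 1)) * \<rho> ^ d * bessel_integral (d - 1) (2 * pi * \<rho> * norm g)))"
proof -
  let ?l = "d - CARD('k)"
  let ?F = "\<lambda>y :: real^'k. ennreal (ball_volume_sq ?l (\<rho>\<^sup>2 - (norm y)\<^sup>2))"
  have "(\<integral>\<^sup>+x. indicator unit_cube x * (ennreal (wave \<sigma> g x) * ennreal (S_vol d \<rho> x)) \<partial>lborel)
      = (\<integral>\<^sup>+x. indicator unit_cube x * (ennreal (wave \<sigma> g x) * (\<Sum>\<gamma>\<in>lattice_points \<rho>. ?F (\<gamma> - x))) \<partial>lborel)"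
    by (intro nn_integral_cong) (auto simp: indicator_def S_vol_eq_sum[OF \<rho>] sum_ennreal)
  also have "\<dots> = (\<integral>\<^sup>+y. ?F y * ennreal (wave \<sigma> g y) \<partial>lborel)"
  proof (rule nn_integral_unfold)
    fix y :: "real^'k" assume "\<rho> \<le> norm y"
    then have "\<rho>\<^sup>2 \<le> (norm y)\<^sup>2" using \<rho> by (intro power_mono) auto
    then show "?F y = 0" by simp
  qed (use wave_periodic[OF g(1)] in auto)
  also have "\<dots> = (\<integral>\<^sup>+y. ?F y * ennreal (1 + \<sigma> * cos (2 * pi * norm g * (y \<bullet> (g /\<^sub>R norm g)))) \<partial>lborel)"
  proof -
    have "2 * pi * norm g * (y \<bullet> (g /\<^sub>R norm g)) = 2 * pi * (y \<bullet> g)" for y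
      using g by simp
    then show ?thesis by (simp only: wave_def)
  qed
  also have "\<dots> = (\<integral>\<^sup>+t. ennreal (ball_volume_sq (?l + CARD('k) - 1) (\<rho>\<^sup>2 - t\<^sup>2)) * ennreal (1 + \<sigma> * cos (2 * pi * norm g * t)) \<partial>lborel)"
    by (rule nn_integral_ball_volume_sq_slice[where \<psi> = "\<lambda>t. ennreal (1 + \<sigma> * cos (2 * pi * norm g * t))"])
      (use g in auto)
  also have "?l + CARD('k) - 1 = d - 1" using d by simp
  also have "(\<integral>\<^sup>+t. ennreal (ball_volume_sq (d - 1) (\<rho>\<^sup>2 - t\<^sup>2)) * ennreal (1 + \<sigma> * cos (2 * pi * norm g * t)) \<partial>lborel)
     = ennreal (unit_ball_vol (real (Suc (d - 1))) * \<rho> ^ Suc (d - 1)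
           + \<sigma> * (unit_ball_vol (real (d - 1)) * \<rho> ^ Suc (d - 1) * bessel_integral (d - 1) (\<rho> * (2 * pi * norm g))))"
    by (rule nn_integral_slice_wave[OF _ \<rho> \<sigma>]) (use d in auto)
  also have "Suc (d - 1) = d" using d by simp
  also have "\<rho> * (2 * pi * norm g) = 2 * pi * \<rho> * norm g" by simp
  finally show ?thesis .
qed

text \<open>
  If the error term were below \<open>c\<close> everywhere, then so would be its mean with respect to the weight
  \<open>wave \<sigma> g\<close>. By the choice of the sign \<open>\<sigma>\<close> this mean is the right-hand side of the assumption.
\<close>

lemma R_err_large:
  fixes g :: "real ^ 'k::finite"
  assumes d: "CARD('k) \<le> d" "2 \<le> d" and \<rho>: "\<rho> > 0" and g: "g \<in> int_lattice" "g \<noteq> 0"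
    and c: "c < unit_ball_vol (real (d - 1)) * \<rho> ^ d * \<bar>bessel_integral (d - 1) (2 * pi * \<rho> * norm g)\<bar>"
  shows "\<exists>x :: real ^ 'k. c \<le> R_err d \<rho> x"
proof (rule ccontr)
  assume "\<not> ?thesis"
  then have less: "S_vol d \<rho> x \<le> unit_ball_vol (real d) * \<rho> ^ d + c" for x :: "real ^ 'k"
    by (simp add: R_err_def not_le) (smt (verit))
  let ?M = "unit_ball_vol (real d) * \<rho> ^ d + c"
  let ?J = "bessel_integral (d - 1) (2 * pi * \<rho> * norm g)"
  define \<sigma> :: real where "\<sigma> = (if ?J \<ge> 0 then 1 else -1)"
  have \<sigma>: "\<bar>\<sigma>\<bar> = 1" "\<sigma> * ?J = \<bar>?J\<bar>" by (auto simp: \<sigma>_def)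
  have M: "0 \<le> ?M" using less[of 0] S_vol_nonneg[of d \<rho> "0 :: real^'k"] by linarith
  have "ennreal (unit_ball_vol (real d) * \<rho> ^ d + \<sigma> * (unit_ball_vol (real (d - 1)) * \<rho> ^ d * ?J))
     = (\<integral>\<^sup>+x. indicator unit_cube x * (ennreal (wave \<sigma> g x) * ennreal (S_vol d \<rho> x)) \<partial>lborel)"
    by (rule nn_integral_wave_S_vol[OF d \<rho> g \<sigma>(1), symmetric])
  also have "\<dots> \<le> (\<integral>\<^sup>+x. indicator unit_cube x * ennreal (wave \<sigma> g x) * ennreal ?M \<partial>lborel)"
    unfolding mult.assoc by (intro nn_integral_mono mult_left_mono ennreal_leI less) auto
  also have "\<dots> = ennreal ?M"
    by (subst nn_integral_multc) (auto simp: nn_integral_wave_unit_cube[OF g \<sigma>(1)])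
  finally have "unit_ball_vol (real d) * \<rho> ^ d + \<sigma> * (unit_ball_vol (real (d - 1)) * \<rho> ^ d * ?J) \<le> ?M"
    using M by (simp add: ennreal_le_iff)
  moreover have "\<sigma> * (unit_ball_vol (real (d - 1)) * \<rho> ^ d * ?J) = unit_ball_vol (real (d - 1)) * \<rho> ^ d * \<bar>?J\<bar>"
    using \<sigma>(2) by (metis mult.assoc mult.commute)
  ultimately show False using c by linarith
qed


section \<open>Lower bounds for the error term\<close>

text \<open>
  The constant \<open>B\<close> is half of the amplitude in \<open>bessel_integral_asymptotics\<close>; the other half absorbs
  the error. It does not depend on \<open>\<kappa>\<close>, only the threshold for \<open>z\<close> does.
\<close>

lemma bessel_integral_lower_bound:
  "\<exists>B>0. \<forall>\<kappa>>0. \<forall>\<^sub>F z in at_top. \<kappa> \<le> \<bar>sin (z - real n * pi / 4)\<bar> \<longrightarrow>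
     B * \<kappa> \<le> sqrt z ^ (n + 2) * \<bar>bessel_integral n z\<bar>"
proof -
  define B where "B = Gamma (real n / 2 + 1) * sqrt 2 ^ n"
  have B: "B > 0" by (simp add: B_def Gamma_real_pos)
  have "\<forall>\<^sub>F z in at_top. \<kappa> \<le> \<bar>sin (z - real n * pi / 4)\<bar> \<longrightarrow>
     B * \<kappa> \<le> sqrt z ^ (n + 2) * \<bar>bessel_integral n z\<bar>" if \<kappa>: "\<kappa> > 0" for \<kappa>
  proof -
    have "\<forall>\<^sub>F z in at_top. \<bar>sqrt z ^ (n + 2) * bessel_integral n z - 2 * Gamma (real n / 2 + 1) * sqrt 2 ^ n * sin (z - real n * pi / 4)\<bar> < B * \<kappa>"
      using tendstoD[OF bessel_integral_asymptotics[of n], of "B * \<kappa>"] B \<kappa>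
      by (simp add: dist_real_def)
    then show ?thesis
      using eventually_ge_at_top[of 0]
    proof eventually_elim
      case (elim z)
      show ?case
      proof
        let ?s = "sin (z - real n * pi / 4)"
        assume "\<kappa> \<le> \<bar>?s\<bar>"
        then have "2 * (B * \<kappa>) \<le> \<bar>2 * B * ?s\<bar>" using B by (simp add: abs_mult)
        also have "2 * B * ?s = 2 * Gamma (real n / 2 + 1) * sqrt 2 ^ n * ?s" by (simp add: B_def)
        finally have "B * \<kappa> \<le> \<bar>sqrt z ^ (n + 2) * bessel_integral n z\<bar>" using elim(1) by linarith
        then show "B * \<kappa> \<le> sqrt z ^ (n + 2) * \<bar>bessel_integral n z\<bar>"
          using elim(2) by (simp add: abs_mult)
      qed
    qed
  qed
  with B show ?thesis by blast
qed

text \<open>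
  The transfer from short good frequencies to the error term: a frequency of length at most
  \<open>K \<rho>\<^sup>\<beta>\<close> loses the factor \<open>\<rho>\<^bsup>-\<beta>(d+1)/2\<^esup>\<close> against the optimal order. Lengths are at least \<open>1\<close>, so the
  argument \<open>2\<pi>\<rho>|g|\<close> of the Bessel integral grows with \<open>\<rho>\<close>.
\<close>

lemma R_err_lower_bound:
  assumes d: "CARD('k) \<le> d" "2 \<le> d" and \<kappa>: "\<kappa> > 0"
    and freq: "\<forall>\<^sub>F \<rho> in at_top. \<exists>g :: real ^ 'k::finite. g \<in> int_lattice \<and> 1 \<le> norm g \<and> norm g \<le> K * \<rho> powr \<beta> \<and>
       \<kappa> \<le> \<bar>sin (2 * pi * \<rho> * norm g - real (d - 1) * pi / 4)\<bar>"
  shows "\<exists>C>0. \<forall>\<^sub>F \<rho> in at_top. \<exists>x :: real ^ 'k. C * \<rho> powr ((real d - 1) / 2 - \<beta> * ((real d + 1) / 2)) \<le> R_err d \<rho> x"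
proof -
  obtain B where B: "B > 0"
    and ev: "\<forall>\<^sub>F z in at_top. \<kappa> \<le> \<bar>sin (z - real (d - 1) * pi / 4)\<bar> \<longrightarrow>
     B * \<kappa> \<le> sqrt z ^ (d - 1 + 2) * \<bar>bessel_integral (d - 1) z\<bar>"
    using bessel_integral_lower_bound[of "d - 1"] \<kappa> by blast
  obtain Z where Z: "\<And>z. z \<ge> Z \<Longrightarrow> \<kappa> \<le> \<bar>sin (z - real (d - 1) * pi / 4)\<bar> \<Longrightarrow>
     B * \<kappa> \<le> sqrt z ^ (d - 1 + 2) * \<bar>bessel_integral (d - 1) z\<bar>"
    using ev by (auto simp: eventually_at_top_linorder)
  define K' where "K' = max K 1"
  define v where "v = unit_ball_vol (real (d - 1))"
  have v: "v > 0" by (simp add: v_def)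
  \<comment> \<open>Half of the bound that results, because the inequality required by \<open>R_err_large\<close> is strict.\<close>
  define C where "C = v * B * \<kappa> / (2 * (2 * pi * K') powr ((real d + 1) / 2))"
  have K': "K' > 0" "K \<le> K'" by (auto simp: K'_def)
  then have C: "C > 0" using v B \<kappa> by (simp add: C_def)
  have "\<forall>\<^sub>F \<rho> in at_top. \<exists>x :: real ^ 'k. C * \<rho> powr ((real d - 1) / 2 - \<beta> * ((real d + 1) / 2)) \<le> R_err d \<rho> x"
    using freq eventually_ge_at_top[of Z] eventually_gt_at_top[of 0]
  proof eventually_elim
    case (elim \<rho>)
    then obtain g :: "real ^ 'k" where g: "g \<in> int_lattice" "1 \<le> norm g" "norm g \<le> K * \<rho> powr \<beta>"
      and sin: "\<kappa> \<le> \<bar>sin (2 * pi * \<rho> * norm g - real (d - 1) * pi / 4)\<bar>" by blast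
    let ?z = "2 * pi * \<rho> * norm g" and ?e = "(real d + 1) / 2"
    have "1 * 1 \<le> 2 * pi * norm g" using g(2) pi_gt3 by (intro mult_mono) auto
    then have "\<rho> * 1 \<le> \<rho> * (2 * pi * norm g)" using elim(3) by (intro mult_left_mono) auto
    then have z: "\<rho> \<le> ?z" by (simp add: mult_ac)
    have "sqrt ?z ^ (d - 1 + 2) = ?z powr ?e"
    proof -
      have "0 < ?z" using z elim(3) by linarith
      moreover have "real (d - 1 + 2) = real d + 1" using d by (simp add: of_nat_diff)
      ultimately show ?thesis by (simp only: sqrt_power_eq_powr)
    qed
    also have "\<dots> \<le> (2 * pi * K' * \<rho> powr (1 + \<beta>)) powr ?e"
    proof (rule powr_mono2)
      have "norm g \<le> K' * \<rho> powr \<beta>" using g(3) mult_right_mono[OF K'(2), of "\<rho> powr \<beta>"] by simp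
      then have "2 * pi * \<rho> * norm g \<le> 2 * pi * \<rho> * (K' * \<rho> powr \<beta>)" using elim(3) by (intro mult_left_mono) auto
      then show "?z \<le> 2 * pi * K' * \<rho> powr (1 + \<beta>)" using elim(3) by (simp add: powr_add mult_ac)
    qed (use z elim(3) in auto)
    also have "\<dots> = (2 * pi * K') powr ?e * \<rho> powr ((1 + \<beta>) * ?e)"
      using K' by (simp add: powr_mult powr_powr)
    finally have zb: "sqrt ?z ^ (d - 1 + 2) \<le> (2 * pi * K') powr ?e * \<rho> powr ((1 + \<beta>) * ?e)" .
    have J: "B * \<kappa> \<le> (2 * pi * K') powr ?e * \<rho> powr ((1 + \<beta>) * ?e) * \<bar>bessel_integral (d - 1) ?z\<bar>"
      using order_trans[OF Z[OF _ sin] mult_right_mono[OF zb]] z elim(2) by auto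
    have e: "(real d - 1) / 2 - \<beta> * ?e = real d - (1 + \<beta>) * ?e" by (simp add: field_simps)
    have "2 * (C * \<rho> powr ((real d - 1) / 2 - \<beta> * ?e)) = v * \<rho> ^ d * (B * \<kappa> / ((2 * pi * K') powr ?e * \<rho> powr ((1 + \<beta>) * ?e)))"
      using elim(3) unfolding e powr_diff C_def by (simp add: powr_realpow)
    also have "\<dots> \<le> v * \<rho> ^ d * \<bar>bessel_integral (d - 1) ?z\<bar>"
      using v elim(3) K' J by (intro mult_left_mono) (auto simp: pos_divide_le_eq mult_ac)
    finally have "2 * (C * \<rho> powr ((real d - 1) / 2 - \<beta> * ?e)) \<le> v * \<rho> ^ d * \<bar>bessel_integral (d - 1) ?z\<bar>" .
    moreover have "0 < C * \<rho> powr ((real d - 1) / 2 - \<beta> * ?e)" using C elim(3) by simp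
    ultimately have "C * \<rho> powr ((real d - 1) / 2 - \<beta> * ?e) < unit_ball_vol (real (d - 1)) * \<rho> ^ d * \<bar>bessel_integral (d - 1) ?z\<bar>"
      unfolding v_def by linarith
    then show ?case
      using g elim(3) by (intro R_err_large[OF d]) auto
  qed
  with C show ?thesis by blast
qed

lemma norm_axis: "norm (axis i a :: real ^ 'k::finite) = \<bar>a\<bar>"
  by (simp add: norm_eq_sqrt_inner inner_axis_axis)

lemma axis_in_int_lattice: "m \<in> \<int> \<Longrightarrow> axis i m \<in> int_lattice"
  by (auto simp: int_lattice_def axis_def)

text \<open>
  If the frequencies \<open>e\<close> and \<open>2e\<close> both had a small sine, then \<open>sin \<theta>\<close> would be small.
\<close>

lemma abs_sin_phase_le:
  "\<bar>sin \<theta>\<bar> \<le> \<bar>sin (2 * z - \<theta>)\<bar> + 2 * \<bar>sin (z - (\<theta> :: real))\<bar>"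
proof -
  have "sin \<theta> = sin ((2 * z - \<theta>) - of_nat 2 * (z - \<theta>))" by (simp add: algebra_simps)
  then show ?thesis
    using abs_sin_diff_le[of "2 * z - \<theta>" "of_nat 2 * (z - \<theta>)"] abs_sin_of_nat_mult_le[of 2 "z - \<theta>"] by simp
qed

text \<open>
  Here the phase \<open>\<theta> = (d - 1)\<pi>/4\<close> is not a multiple of \<open>\<pi>\<close>, and by \<open>abs_sin_phase_le\<close> one of
  the frequencies \<open>e\<close> and \<open>2e\<close> is good, where \<open>e\<close> is a standard basis vector.
\<close>

lemma R_err_lower_bound_not_1_mod_4:
  assumes d: "CARD('k::finite) \<le> d" and mod: "d mod 4 \<noteq> 1"
  shows "\<exists>C>0. \<forall>\<^sub>F \<rho> in at_top. \<exists>x :: real ^ 'k. C * \<rho> powr ((real d - 1) / 2) \<le> R_err d \<rho> x"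
proof -
  have "0 < CARD('k)" by simp
  with d have "1 \<le> d" by linarith
  moreover have "d \<noteq> 1" using mod by auto
  ultimately have d2: "2 \<le> d" by linarith
  let ?\<theta> = "real (d - 1) * pi / 4"
  have "sin ?\<theta> \<noteq> 0"
  proof
    assume "sin ?\<theta> = 0"
    then obtain i where "?\<theta> = of_int i * pi" using sin_zero_iff_int2 by blast
    then have "real_of_int (int (d - 1)) = real_of_int (4 * i)" by simp
    then have "int (d - 1) = 4 * i" by (simp only: of_int_eq_iff)
    then show False using mod d2 by presburger
  qed
  then have \<kappa>: "\<bar>sin ?\<theta>\<bar> / 3 > 0" by simp
  have "\<exists>g :: real ^ 'k. g \<in> int_lattice \<and> 1 \<le> norm g \<and> norm g \<le> 2 * \<rho> powr 0 \<and>
       \<bar>sin ?\<theta>\<bar> / 3 \<le> \<bar>sin (2 * pi * \<rho> * norm g - ?\<theta>)\<bar>" if "\<rho> > 0" for \<rho>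
  proof -
    fix i :: 'k
    consider "\<bar>sin ?\<theta>\<bar> / 3 \<le> \<bar>sin (2 * pi * \<rho> - ?\<theta>)\<bar>" | "\<bar>sin ?\<theta>\<bar> / 3 \<le> \<bar>sin (2 * (2 * pi * \<rho>) - ?\<theta>)\<bar>"
      using abs_sin_phase_le[of ?\<theta> "2 * pi * \<rho>"] by linarith
    then show ?thesis
    proof cases
      case 1
      then show ?thesis
        using that by (intro exI[of _ "axis i 1"]) (simp add: axis_in_int_lattice norm_axis)
    next
      case 2
      have "2 * (2 * pi * \<rho>) = 2 * pi * \<rho> * 2" by simp
      with 2 that show ?thesis
        by (intro exI[of _ "axis i 2"]) (simp add: axis_in_int_lattice norm_axis)
    qed
  qed
  then have "\<forall>\<^sub>F \<rho> in at_top. \<exists>g :: real ^ 'k. g \<in> int_lattice \<and> 1 \<le> norm g \<and> norm g \<le> 2 * \<rho> powr 0 \<and>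
       \<bar>sin ?\<theta>\<bar> / 3 \<le> \<bar>sin (2 * pi * \<rho> * norm g - ?\<theta>)\<bar>"
    by (intro eventually_mono[OF eventually_gt_at_top[of 0]])
  from R_err_lower_bound[OF d d2 \<kappa> this] show ?thesis by simp
qed

lemma norm_axis_plus_axis:
  assumes "i \<noteq> j" shows "norm (axis i a + axis j b :: real ^ 'k::finite) = sqrt (a\<^sup>2 + b\<^sup>2)"
proof -
  have "axis i a \<bullet> (axis j b :: real ^ 'k) = 0" using assms by (simp add: inner_axis_axis)
  then have "(norm (axis i a + axis j b :: real ^ 'k))\<^sup>2 = a\<^sup>2 + b\<^sup>2"
    by (subst norm_add_Pythagorean) (auto simp: orthogonal_def norm_axis)
  then show ?thesis by (metis norm_ge_zero real_sqrt_unique)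
qed

text \<open>
  Here the phase is a multiple of \<open>\<pi>\<close>, and the frequencies are \<open>(m, 1, 0, \<dots>)\<close>. The order \<open>s\<close> of the
  combination of norms is chosen so large that the loss \<open>\<rho>\<^bsup>-(d+1)/(2p)\<^esup>\<close>, with \<open>p = 2 s - 1\<close>,
  is smaller than \<open>\<rho>\<^bsup>-\<epsilon>/2\<^esup>\<close>; the spare power of \<open>\<rho>\<close> then absorbs the constant, which depends on
  \<open>\<epsilon>\<close>.
\<close>

lemma R_err_lower_bound_1_mod_4:
  assumes d: "CARD('k::finite) \<le> d" and k: "CARD('k) > 1" and mod: "d mod 4 = 1" and \<epsilon>: "\<epsilon> > 0"
  shows "\<forall>\<^sub>F \<rho> in at_top. \<exists>x :: real ^ 'k. \<rho> powr ((real d - 1 - \<epsilon>) / 2) \<le> R_err d \<rho> x"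
proof -
  have d2: "2 \<le> d" using d k by simp
  obtain i j :: 'k where ij: "i \<noteq> j"
    using k card_le_Suc0_iff_eq[of "UNIV :: 'k set"] by (auto simp: not_le)
  obtain q where q: "d - 1 = 4 * q" using mod d2 by (metis add_diff_cancel_right' div_mult_mod_eq mult.commute)
  have phase: "\<bar>sin (z - real (d - 1) * pi / 4)\<bar> = \<bar>sin z\<bar>" for z
  proof -
    have "real (d - 1) * pi / 4 = real q * pi" unfolding q by simp
    then show ?thesis by (simp add: sin_diff abs_mult power_abs)
  qed
  obtain s :: nat where s: "(real d + 1) / \<epsilon> + 1 < real s" using reals_Archimedean2 by blast
  then have s0: "s > 0" using \<epsilon> by (cases "s = 0") (auto simp: field_simps)
  define p where "p = real (2 * s - 1)"
  have p: "(real d + 1) / \<epsilon> < p" "p > 0"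
    using s s0 by (auto simp: p_def of_nat_diff)
  obtain \<kappa> K where \<kappa>: "\<kappa> > 0" and ev: "\<forall>\<^sub>F \<rho> in at_top. \<exists>m::nat. m \<ge> 1 \<and>
           sqrt ((real m)\<^sup>2 + 1) \<le> K * \<rho> powr (1 / p) \<and>
           \<kappa> \<le> \<bar>sin (2 * pi * \<rho> * sqrt ((real m)\<^sup>2 + 1))\<bar>"
    using sin_sqrt_square_plus_one_large[OF s0] unfolding p_def by blast
  have "\<forall>\<^sub>F \<rho> in at_top. \<exists>g :: real ^ 'k. g \<in> int_lattice \<and> 1 \<le> norm g \<and> norm g \<le> K * \<rho> powr (1 / p) \<and>
       \<kappa> \<le> \<bar>sin (2 * pi * \<rho> * norm g - real (d - 1) * pi / 4)\<bar>"
    using ev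
  proof eventually_elim
    case (elim \<rho>)
    then obtain m :: nat where m: "sqrt ((real m)\<^sup>2 + 1) \<le> K * \<rho> powr (1 / p)"
      "\<kappa> \<le> \<bar>sin (2 * pi * \<rho> * sqrt ((real m)\<^sup>2 + 1))\<bar>" by blast
    let ?g = "axis i (real m) + axis j 1 :: real ^ 'k"
    have norm_g: "norm ?g = sqrt ((real m)\<^sup>2 + 1)" using norm_axis_plus_axis[OF ij, of "real m" 1] by simp
    have "?g \<in> int_lattice" by (intro int_lattice_add axis_in_int_lattice) auto
    moreover have "1 \<le> norm ?g" unfolding norm_g by simp
    moreover have "norm ?g \<le> K * \<rho> powr (1 / p)" unfolding norm_g by (rule m(1))
    moreover have "\<kappa> \<le> \<bar>sin (2 * pi * \<rho> * norm ?g - real (d - 1) * pi / 4)\<bar>" unfolding norm_g phase by (rule m(2))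
    ultimately show ?case by blast
  qed
  from R_err_lower_bound[OF d d2 \<kappa> this] obtain C where C: "C > 0"
    and lower: "\<forall>\<^sub>F \<rho> in at_top. \<exists>x :: real ^ 'k. C * \<rho> powr ((real d - 1) / 2 - 1 / p * ((real d + 1) / 2)) \<le> R_err d \<rho> x"
    by blast
  define \<delta> where "\<delta> = \<epsilon> / 2 - 1 / p * ((real d + 1) / 2)"
  have "\<delta> > 0" using p \<epsilon> by (simp add: \<delta>_def field_simps)
  then have "filterlim (\<lambda>\<rho>. C * \<rho> powr \<delta>) at_top at_top" using C by real_asymp
  then have "\<forall>\<^sub>F \<rho> in at_top. 1 \<le> C * \<rho> powr \<delta>" by (simp add: filterlim_at_top)
  with lower show ?thesis
  proof eventually_elim
    case (elim \<rho>)
    then obtain x :: "real ^ 'k" where x: "C * \<rho> powr ((real d - 1) / 2 - 1 / p * ((real d + 1) / 2)) \<le> R_err d \<rho> x" by blast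
    have "\<rho> powr ((real d - 1 - \<epsilon>) / 2) \<le> C * \<rho> powr \<delta> * \<rho> powr ((real d - 1 - \<epsilon>) / 2)"
      using mult_right_mono[OF elim(2), of "\<rho> powr ((real d - 1 - \<epsilon>) / 2)"] by simp
    also have "\<dots> = C * \<rho> powr ((real d - 1) / 2 - 1 / p * ((real d + 1) / 2))"
      by (simp add: powr_add[symmetric] \<delta>_def mult.assoc diff_divide_distrib)
    finally show ?case using x order_trans by blast
  qed
qed

lemma eventually_R_torus:
  assumes "\<forall>\<^sub>F \<rho> in at_top. \<exists>x :: real ^ 'k::finite. f \<rho> \<le> R_err d \<rho> x"
  shows "\<exists>\<rho>\<^sub>0>0. \<forall>\<rho>\<ge>\<rho>\<^sub>0. \<exists>k\<^sub>1 :: 'k torus. R_torus d \<rho> k\<^sub>1 \<ge> f \<rho>"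
proof -
  obtain \<rho>\<^sub>0 where "\<And>\<rho>. \<rho> \<ge> \<rho>\<^sub>0 \<Longrightarrow> \<exists>x :: real ^ 'k. f \<rho> \<le> R_err d \<rho> x"
    using assms by (auto simp: eventually_at_top_linorder)
  then have "\<forall>\<rho>\<ge>max \<rho>\<^sub>0 1. \<exists>k\<^sub>1 :: 'k torus. R_torus d \<rho> k\<^sub>1 \<ge> f \<rho>"
    by (metis R_torus.abs_eq max.bounded_iff)
  then show ?thesis by (intro exI[of _ "max \<rho>\<^sub>0 1"]) simp
qed

theorem theorem1p3:
  fixes d :: nat
  assumes "1 \<le> CARD('k::finite)" and "CARD('k) \<le> d"
  shows
    "(CARD('k) > 1 \<longrightarrow>
       (d mod 4 \<noteq> 1 \<longrightarrow>
         (\<exists>C>0. \<exists>\<rho>\<^sub>0>0. \<forall>\<rho>\<ge>\<rho>\<^sub>0. \<exists>k\<^sub>1 :: 'k torus.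
            R_torus d \<rho> k\<^sub>1 \<ge> C * \<rho> powr ((real d - 1) / 2))) \<and>
       (d mod 4 = 1 \<longrightarrow>
         (\<exists>C>0. \<forall>\<epsilon>>0. \<exists>\<rho>\<^sub>0>0. \<forall>\<rho>\<ge>\<rho>\<^sub>0. \<exists>k\<^sub>1 :: 'k torus.
            R_torus d \<rho> k\<^sub>1 \<ge> C * \<rho> powr ((real d - 1 - \<epsilon>) / 2)))) \<and>
     (CARD('k) = 1 \<and> d mod 4 \<noteq> 1 \<longrightarrow>
       (\<exists>C>0. \<exists>\<rho>\<^sub>0>0. \<forall>\<rho>\<ge>\<rho>\<^sub>0. \<exists>k\<^sub>1 :: 'k torus.
          R_torus d \<rho> k\<^sub>1 \<ge> C * \<rho> powr ((real d - 1) / 2)))"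
proof -
  have generic: "\<exists>C>0. \<exists>\<rho>\<^sub>0>0. \<forall>\<rho>\<ge>\<rho>\<^sub>0. \<exists>k\<^sub>1 :: 'k torus. R_torus d \<rho> k\<^sub>1 \<ge> C * \<rho> powr ((real d - 1) / 2)"
    if mod4: "d mod 4 \<noteq> 1"
  proof -
    obtain C where "C > 0" and
      "\<forall>\<^sub>F \<rho> in at_top. \<exists>x :: real ^ 'k. C * \<rho> powr ((real d - 1) / 2) \<le> R_err d \<rho> x"
      using R_err_lower_bound_not_1_mod_4[OF assms(2) mod4] by blast
    from this(1) eventually_R_torus[OF this(2)] show ?thesis by blast
  qed
  have exceptional: "\<exists>C>0. \<forall>\<epsilon>>0. \<exists>\<rho>\<^sub>0>0. \<forall>\<rho>\<ge>\<rho>\<^sub>0. \<exists>k\<^sub>1 :: 'k torus.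
      R_torus d \<rho> k\<^sub>1 \<ge> C * \<rho> powr ((real d - 1 - \<epsilon>) / 2)"
    if "CARD('k) > 1" "d mod 4 = 1"
    using eventually_R_torus[OF R_err_lower_bound_1_mod_4[OF assms(2) that]]
    by (intro exI[of _ "1 :: real"]) simp
  show ?thesis using generic exceptional by blast
qed

end
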